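(* Let $q_0>0$, $d_0>0$, $\sigma>0$ and $0<b\leqslant 1$ be constants and let $(B_t)_{t\geqslant 0}$ be a standard Brownian motion. The solution of the stochastic differential equation $$\mathrm{d}Q_t = -\frac{d_0Q_t}{1+bd_0t}\,\mathrm{d}t + \sigma\,\mathrm{d}B_t,\qquad Q_0=q_0,$$ is $$\forall t\geqslant 0,\quad Q_t = q_0(1+bd_0t)^{-1/b} + \sigma(1+bd_0t)^{-1/b}\int_0^t(1+bd_0u)^{1/b}\,\mathrm{d}B_u .$$
   Context: "The solution" means the unique strong solution of the stochastic differential equation (in the Itô sense) driven by the given Brownian motion $(B_t)$. *)

theory Defs
  imports "HOL-Probability.Probability"
begin

text \<open>
  Continuous-time real processes are functions of type \<open>real \<Rightarrow> 'a \<Rightarrow> real\<close>; only their values at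
  times \<open>t \<ge> 0\<close> are relevant.
\<close>

definition standard_brownian_motion :: "'a measure \<Rightarrow> (real \<Rightarrow> 'a \<Rightarrow> real) \<Rightarrow> bool" where
  "standard_brownian_motion M B \<longleftrightarrow>
     (\<forall>t\<ge>0. B t \<in> borel_measurable M) \<and>
     (AE \<omega> in M. B 0 \<omega> = 0) \<and>
     (\<forall>n (\<tau> :: nat \<Rightarrow> real). 0 \<le> \<tau> 0 \<and> (\<forall>i<n. \<tau> i \<le> \<tau> (Suc i)) \<longrightarrow>
        prob_space.indep_vars M (\<lambda>_. borel) (\<lambda>i \<omega>. B (\<tau> (Suc i)) \<omega> - B (\<tau> i) \<omega>) {..<n}) \<and>
     (\<forall>s t. 0 \<le> s \<and> s < t \<longrightarrow>
        distributed M lborel (\<lambda>\<omega>. B t \<omega> - B s \<omega>) (normal_density 0 (sqrt (t - s)))) \<and>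
     (AE \<omega> in M. continuous_on {0..} (\<lambda>t. B t \<omega>))"

text \<open>
  The filtration generated by \<open>B\<close>, augmented by the null sets of \<open>M\<close>. The space \<open>M\<close> is not assumed
  complete, so the augmentation consists of the null events belonging to \<open>M\<close>.
\<close>

definition brownian_filtration :: "'a measure \<Rightarrow> (real \<Rightarrow> 'a \<Rightarrow> real) \<Rightarrow> real \<Rightarrow> 'a measure" where
  "brownian_filtration M B t =
     sigma (space M)
       (null_sets M \<union> {B s -` A \<inter> space M | s A. 0 \<le> s \<and> s \<le> t \<and> A \<in> sets borel})"

definition adapted_process :: "(real \<Rightarrow> 'a measure) \<Rightarrow> (real \<Rightarrow> 'a \<Rightarrow> real) \<Rightarrow> bool" where
  "adapted_process F X \<longleftrightarrow> (\<forall>t\<ge>0. X t \<in> borel_measurable (F t))"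

definition progressively_measurable :: "(real \<Rightarrow> 'a measure) \<Rightarrow> (real \<Rightarrow> 'a \<Rightarrow> real) \<Rightarrow> bool" where
  "progressively_measurable F X \<longleftrightarrow>
     (\<forall>t\<ge>0. (\<lambda>(s, \<omega>). X s \<omega>) \<in> borel_measurable (restrict_space borel {0..t} \<Otimes>\<^sub>M F t))"

definition continuous_paths :: "'a measure \<Rightarrow> (real \<Rightarrow> 'a \<Rightarrow> real) \<Rightarrow> bool" where
  "continuous_paths M X \<longleftrightarrow> (AE \<omega> in M. continuous_on {0..} (\<lambda>t. X t \<omega>))"

definition indistinguishable ::
  "'a measure \<Rightarrow> (real \<Rightarrow> 'a \<Rightarrow> real) \<Rightarrow> (real \<Rightarrow> 'a \<Rightarrow> real) \<Rightarrow> bool" where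
  "indistinguishable M X Y \<longleftrightarrow> (AE \<omega> in M. \<forall>t\<ge>0. X t \<omega> = Y t \<omega>)"

definition tendsto_in_probability ::
  "'a measure \<Rightarrow> (nat \<Rightarrow> 'a \<Rightarrow> real) \<Rightarrow> ('a \<Rightarrow> real) \<Rightarrow> bool" where
  "tendsto_in_probability M X Y \<longleftrightarrow>
     (\<forall>k. X k \<in> borel_measurable M) \<and> Y \<in> borel_measurable M \<and>
     (\<forall>\<epsilon>>0. (\<lambda>k. measure M {\<omega> \<in> space M. \<bar>X k \<omega> - Y \<omega>\<bar> > \<epsilon>}) \<longlonglongrightarrow> 0)"

text \<open>
  A simple integrand is given by a partition \<open>\<tau> 0 \<le> \<dots> \<le> \<tau> n\<close> and bounded random variables
  \<open>\<xi> i\<close>, \<open>i < n\<close>, known at the left endpoints; it stands for the left-continuous process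
  \<open>\<Sum>i<n. \<xi> i \<omega> * indicator {\<tau> i<..\<tau> (Suc i)} t\<close>.
\<close>

definition simple_integrand ::
  "(real \<Rightarrow> 'a measure) \<Rightarrow> nat \<Rightarrow> (nat \<Rightarrow> real) \<Rightarrow> (nat \<Rightarrow> 'a \<Rightarrow> real) \<Rightarrow> bool" where
  "simple_integrand F n \<tau> \<xi> \<longleftrightarrow>
     0 \<le> \<tau> 0 \<and> (\<forall>i<n. \<tau> i \<le> \<tau> (Suc i)) \<and>
     (\<forall>i<n. \<xi> i \<in> borel_measurable (F (\<tau> i)) \<and> (\<exists>C. \<forall>\<omega>\<in>space (F (\<tau> i)). \<bar>\<xi> i \<omega>\<bar> \<le> C))"

definition simple_process ::
  "nat \<Rightarrow> (nat \<Rightarrow> real) \<Rightarrow> (nat \<Rightarrow> 'a \<Rightarrow> real) \<Rightarrow> real \<Rightarrow> 'a \<Rightarrow> real" where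
  "simple_process n \<tau> \<xi> t \<omega> = (\<Sum>i<n. \<xi> i \<omega> * indicator {\<tau> i<..\<tau> (Suc i)} t)"

definition simple_ito_integral ::
  "(real \<Rightarrow> 'a \<Rightarrow> real) \<Rightarrow> nat \<Rightarrow> (nat \<Rightarrow> real) \<Rightarrow> (nat \<Rightarrow> 'a \<Rightarrow> real) \<Rightarrow> real \<Rightarrow> 'a \<Rightarrow> real" where
  "simple_ito_integral B n \<tau> \<xi> t \<omega> =
     (\<Sum>i<n. \<xi> i \<omega> * (B (min (\<tau> (Suc i)) t) \<omega> - B (min (\<tau> i) t) \<omega>))"

definition ito_integrable :: "'a measure \<Rightarrow> (real \<Rightarrow> 'a measure) \<Rightarrow> (real \<Rightarrow> 'a \<Rightarrow> real) \<Rightarrow> bool" where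
  "ito_integrable M F H \<longleftrightarrow>
     progressively_measurable F H \<and>
     (AE \<omega> in M. \<forall>T\<ge>0. set_integrable lborel {0..T} (\<lambda>s. (H s \<omega>)\<^sup>2))"

text \<open>
  The Ito integral process of \<open>H\<close> against \<open>B\<close> is the continuous adapted process obtained as the
  limit in probability of integrals of simple processes that approximate \<open>H\<close> in
  \<open>L\<^sup>2([0,T])\<close> in probability, for every \<open>T\<close>. Here \<open>B\<close> is meant to be a Brownian motion with respect
  to the filtration \<open>F\<close>; the limit then does not depend on the approximating sequence, and the
  process is unique up to indistinguishability.
\<close>

definition is_ito_integral ::
  "'a measure \<Rightarrow> (real \<Rightarrow> 'a measure) \<Rightarrow> (real \<Rightarrow> 'a \<Rightarrow> real) \<Rightarrow> (real \<Rightarrow> 'a \<Rightarrow> real) \<Rightarrow>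
     (real \<Rightarrow> 'a \<Rightarrow> real) \<Rightarrow> bool" where
  "is_ito_integral M F B H I \<longleftrightarrow>
     ito_integrable M F H \<and> adapted_process F I \<and> continuous_paths M I \<and>
     (\<exists>n \<tau> \<xi>.
        (\<forall>k::nat. simple_integrand F (n k) (\<tau> k) (\<xi> k)) \<and>
        (\<forall>T\<ge>0. tendsto_in_probability M
           (\<lambda>k \<omega>. LBINT s:{0..T}. (simple_process (n k) (\<tau> k) (\<xi> k) s \<omega> - H s \<omega>)\<^sup>2) (\<lambda>\<omega>. 0)) \<and>
        (\<forall>t\<ge>0. tendsto_in_probability M
           (\<lambda>k. simple_ito_integral B (n k) (\<tau> k) (\<xi> k) t) (I t)))"

definition ito_integral ::
  "'a measure \<Rightarrow> (real \<Rightarrow> 'a measure) \<Rightarrow> (real \<Rightarrow> 'a \<Rightarrow> real) \<Rightarrow> (real \<Rightarrow> 'a \<Rightarrow> real) \<Rightarrow>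
     real \<Rightarrow> 'a \<Rightarrow> real" where
  "ito_integral M F B H = (SOME I. is_ito_integral M F B H I)"

text \<open>
  Strong solution, driven by \<open>B\<close>, of \<open>dX\<^sub>t = \<mu>(t, X\<^sub>t) dt + \<nu>(t, X\<^sub>t) dB\<^sub>t\<close> with deterministic initial
  value \<open>x0\<close>. Being strong means that \<open>X\<close> is adapted to the augmented filtration of \<open>B\<close> itself.
\<close>

definition strong_solution ::
  "'a measure \<Rightarrow> (real \<Rightarrow> 'a \<Rightarrow> real) \<Rightarrow> (real \<Rightarrow> real \<Rightarrow> real) \<Rightarrow> (real \<Rightarrow> real \<Rightarrow> real) \<Rightarrow> real \<Rightarrow>
     (real \<Rightarrow> 'a \<Rightarrow> real) \<Rightarrow> bool" where
  "strong_solution M B \<mu> \<nu> x0 X \<longleftrightarrow>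
     adapted_process (brownian_filtration M B) X \<and> continuous_paths M X \<and>
     (AE \<omega> in M. X 0 \<omega> = x0) \<and>
     (AE \<omega> in M. \<forall>t\<ge>0. set_integrable lborel {0..t} (\<lambda>s. \<mu> s (X s \<omega>))) \<and>
     ito_integrable M (brownian_filtration M B) (\<lambda>s \<omega>. \<nu> s (X s \<omega>)) \<and>
     (AE \<omega> in M. \<forall>t\<ge>0.
        X t \<omega> = x0 + (LBINT s:{0..t}. \<mu> s (X s \<omega>))
          + ito_integral M (brownian_filtration M B) B (\<lambda>s \<omega>. \<nu> s (X s \<omega>)) t \<omega>)"

definition unique_strong_solution ::
  "'a measure \<Rightarrow> (real \<Rightarrow> 'a \<Rightarrow> real) \<Rightarrow> (real \<Rightarrow> real \<Rightarrow> real) \<Rightarrow> (real \<Rightarrow> real \<Rightarrow> real) \<Rightarrow> real \<Rightarrow>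
     (real \<Rightarrow> 'a \<Rightarrow> real) \<Rightarrow> bool" where
  "unique_strong_solution M B \<mu> \<nu> x0 X \<longleftrightarrow>
     strong_solution M B \<mu> \<nu> x0 X \<and>
     (\<forall>Y. strong_solution M B \<mu> \<nu> x0 Y \<longrightarrow> indistinguishable M Y X)"

end

theory Submission
  imports Defs
begin

text \<open>
  A deterministic \<open>C\<^sup>1\<close> integrand \<open>f\<close> can be integrated pathwise by parts: the Riemann sums over uniform
  grids converge on every continuous path, so \<open>f t * B t - \<integral>\<^sub>0\<^sup>t f' s * B s ds\<close> is a version of its Ito
  integral. Ito integrals are unique up to indistinguishability: on a common refinement, the
  difference of two approximating simple integrals is small in probability by the Ito isometry,
  applied to a truncated integrand. With \<open>f t = (1 + b d\<^sub>0 t)\<^sup>1\<^sup>/\<^sup>b\<close> and constant noise coefficient, the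
  equation then holds path by path, as a linear integral equation with a continuous forcing term
  and integrating factor \<open>f\<close>, whose solution is unique.
\<close>

section \<open>Time grids\<close>

text \<open>\<open>ito_integral\<close> is a \<open>SOME\<close> choice, so nothing is known about
  its value until existence and uniqueness of the integral are both proved. Its definition controls
  the \<open>L\<^sup>2([0,T])\<close> errors only in probability, so the expectation of the squared
  difference of two approximations need not be small; this is why the isometry is used through a
  truncation. The isometry in turn needs an increment after time s to be independent of all of
  \<open>F s\<close>, while Brownian motion is given by independence of finitely many increments and
  \<open>F s\<close> also contains null events; a pi-system argument closes this gap. The null
  events are useful too: a process may be reset on a null set of bad paths and stay adapted.
  Brownian paths are merely continuous, so integration by parts puts all differentiability on
  \<open>f\<close>, which is the exponential of the integrated decay rate
  \<open>d\<^sub>0 / (1 + b * d\<^sub>0 * t)\<close>. The Ito term of the equation is almost surely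
  \<sigma> times \<open>B\<close>, the same for every candidate solution, so existence and
  uniqueness reduce to calculus on each path outside a null set.\<close>

lemma steps_mono:
  fixes p :: "nat \<Rightarrow> real"
  assumes "\<And>i. i < n \<Longrightarrow> p i \<le> p (Suc i)" "j \<le> k" "k \<le> n"
  shows "p j \<le> p k"
  using assms(2,3)
proof (induction rule: dec_induct)
  case (step i)
  then show ?case using assms(1)[of i] by simp
qed simp

text \<open>Strictness lets comparisons of times be replaced by comparisons of indices, which is how
  the position of a partition point relative to a cell is decided later.\<close>

locale time_grid =
  fixes p :: "nat \<Rightarrow> real" and m :: nat and t :: real
  assumes strict: "strict_mono_on {..m} p" and first: "p 0 = 0" and last: "p m = t"
begin

lemma less_iff: "i \<le> m \<Longrightarrow> j \<le> m \<Longrightarrow> p i < p j \<longleftrightarrow> i < j"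
  using strict_mono_on_less[OF strict, of i j] by simp

lemma le_iff: "i \<le> m \<Longrightarrow> j \<le> m \<Longrightarrow> p i \<le> p j \<longleftrightarrow> i \<le> j"
  using strict_mono_on_less_eq[OF strict, of i j] by simp

lemma bounds: "i \<le> m \<Longrightarrow> 0 \<le> p i \<and> p i \<le> t"
  using le_iff[of 0 i] le_iff[of i m] by (simp add: first last)

end

text \<open>Sorting the finite set without repetition gives the grid. This supplies common
  refinements of several partitions.\<close>

lemma time_grid_exists:
  assumes P: "finite P" "P \<subseteq> {0..t}" "0 \<in> P" "t \<in> P"
  obtains p m where "time_grid p m t" "p ` {..m} = P"
proof -
  define l where "l = sorted_list_of_set P"
  define m where "m = length l - 1"
  have len: "length l > 0" using P by (auto simp: l_def card_gt_0_iff)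
  have less: "i < length l \<longleftrightarrow> i \<le> m" for i using len by (cases "length l") (auto simp: m_def)
  have strict: "strict_mono_on {..m} ((!) l)"
    using sorted_wrt_nth_less[of "(<)" l] less by (auto simp: strict_mono_on_def l_def)
  have "(!) l ` {..<length l} = set l" by (auto simp: set_conv_nth)
  moreover have "{..<length l} = {..m}" using less by auto
  ultimately have img: "(!) l ` {..m} = P" using P by (simp add: l_def)
  have mono: "l ! i \<le> l ! j" if "i \<le> j" "j \<le> m" for i j
    using strict_mono_on_leD[OF strict] that by simp
  obtain i where "i \<le> m" "l ! i = 0" using img P(3) by force
  then have "l ! 0 \<le> 0" using mono[of 0 i] by simp
  moreover obtain j where "j \<le> m" "l ! j = t" using img P(4) by force
  then have "t \<le> l ! m" using mono[of j m] by simp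
  moreover have "l ! 0 \<in> {0..t}" "l ! m \<in> {0..t}" using img P(2) by auto
  ultimately have "time_grid ((!) l) m t" using strict by unfold_locales auto
  then show thesis using img by (rule that)
qed

section \<open>The augmented Brownian filtration\<close>

locale brownian_motion = prob_space M for M :: "'a measure" +
  fixes B :: "real \<Rightarrow> 'a \<Rightarrow> real"
  assumes standard: "standard_brownian_motion M B"
begin

abbreviation F :: "real \<Rightarrow> 'a measure" where
  "F \<equiv> brownian_filtration M B"

lemma B_measurable: "0 \<le> t \<Longrightarrow> B t \<in> borel_measurable M"
  using standard by (simp add: standard_brownian_motion_def)

lemma B_zero: "AE \<omega> in M. B 0 \<omega> = 0"
  using standard by (simp add: standard_brownian_motion_def)

lemma B_continuous: "AE \<omega> in M. continuous_on {0..} (\<lambda>t. B t \<omega>)"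
  using standard by (simp add: standard_brownian_motion_def)

lemma B_indep_increments:
  assumes "0 \<le> \<tau> 0" "\<And>i. i < n \<Longrightarrow> \<tau> i \<le> \<tau> (Suc i)"
  shows "indep_vars (\<lambda>_. borel) (\<lambda>i \<omega>. B (\<tau> (Suc i)) \<omega> - B (\<tau> i) \<omega>) {..<n}"
  using standard assms by (simp add: standard_brownian_motion_def)

lemma B_increment_normal:
  assumes "0 \<le> s" "s < t"
  shows "distributed M lborel (\<lambda>\<omega>. B t \<omega> - B s \<omega>) (normal_density 0 (sqrt (t - s)))"
  using standard assms by (simp add: standard_brownian_motion_def)

lemma generators_subset:
  "null_sets M \<union> {B s -` A \<inter> space M | s A. 0 \<le> s \<and> s \<le> t \<and> A \<in> sets borel} \<subseteq> sets M"
  using B_measurable by (auto intro: measurable_sets)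

lemma space_F [simp]: "space (F t) = space M"
  unfolding brownian_filtration_def
  by (rule space_measure_of) (rule order_trans[OF generators_subset sets.space_closed])

lemma sets_F:
  "sets (F t) = sigma_sets (space M)
     (null_sets M \<union> {B s -` A \<inter> space M | s A. 0 \<le> s \<and> s \<le> t \<and> A \<in> sets borel})"
  unfolding brownian_filtration_def
  by (rule sets_measure_of) (rule order_trans[OF generators_subset sets.space_closed])

lemma subalgebra_F: "subalgebra M (F t)"
  unfolding subalgebra_def sets_F
  by (intro conjI space_F sets.sigma_sets_subset generators_subset)

lemma measurable_F_imp: "X \<in> borel_measurable (F t) \<Longrightarrow> X \<in> borel_measurable M"
  using measurable_from_subalg[OF subalgebra_F] .

lemma sets_F_mono: "s \<le> t \<Longrightarrow> sets (F s) \<subseteq> sets (F t)"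
  unfolding sets_F
proof (intro sigma_sets_mono' Un_mono order_refl subsetI)
  fix a assume "s \<le> t" "a \<in> {B r -` A \<inter> space M | r A. 0 \<le> r \<and> r \<le> s \<and> A \<in> sets borel}"
  then obtain r A where "a = B r -` A \<inter> space M" "0 \<le> r" "r \<le> t" "A \<in> sets borel" by auto
  then show "a \<in> {B r -` A \<inter> space M | r A. 0 \<le> r \<and> r \<le> t \<and> A \<in> sets borel}" by blast
qed

lemma measurable_F_mono:
  "s \<le> t \<Longrightarrow> X \<in> borel_measurable (F s) \<Longrightarrow> X \<in> borel_measurable (F t)"
  by (rule measurable_from_subalg[rotated]) (use sets_F_mono in \<open>auto simp: subalgebra_def\<close>)

text \<open>This is what allows an adapted process to be redefined on a null event, already at time
  0.\<close>

lemma null_sets_in_F: "N \<in> null_sets M \<Longrightarrow> N \<in> sets (F t)"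
  unfolding sets_F by (rule sigma_sets.Basic) simp

lemma B_measurable_F: "0 \<le> s \<Longrightarrow> s \<le> t \<Longrightarrow> B s \<in> borel_measurable (F t)"
  unfolding measurable_def sets_F by (auto intro!: sigma_sets.Basic)

text \<open>On a grid through the times of \<open>T\<close>, each \<open>B r - B 0\<close> is a
  partial sum of grid increments up to time s, and the increment from s to t is one further grid
  increment. Independence of disjoint blocks of increments then gives the product formula.\<close>

lemma cylinder_indep_increment:
  assumes T: "finite T" "T \<subseteq> {0..s}" and A: "\<And>r. r \<in> T \<Longrightarrow> A r \<in> sets borel"
    and st: "0 \<le> s" "s < t" and C: "C \<in> sets borel"
  shows "prob ({\<omega> \<in> space M. \<forall>r\<in>T. B r \<omega> \<in> A r} \<inter> ((\<lambda>\<omega>. B t \<omega> - B s \<omega>) -` C \<inter> space M)) =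
    prob {\<omega> \<in> space M. \<forall>r\<in>T. B r \<omega> \<in> A r} * prob ((\<lambda>\<omega>. B t \<omega> - B s \<omega>) -` C \<inter> space M)"
proof -
  let ?P = "insert 0 (insert s T)"
  obtain p m where "time_grid p m s" and p: "p ` {..m} = ?P"
    by (rule time_grid_exists[of ?P s]) (use T st in auto)
  then interpret time_grid p m s by simp
  define k where "k r = (SOME i. i \<le> m \<and> p i = r)" for r
  have k: "k r \<le> m \<and> p (k r) = r" if "r \<in> T" for r
  proof -
    have "\<exists>i. i \<le> m \<and> p i = r" using p that by (metis atMost_iff imageE insertI2)
    then show ?thesis unfolding k_def by (rule someI_ex)
  qed
  \<comment> \<open>The grid ends at s; \<open>q\<close> appends t as point \<open>Suc m\<close>, so
    that increment number \<open>m\<close> is the one from s to t.\<close>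
  define q where "q i = (if i \<le> m then p i else t)" for i
  define X where "X i \<omega> = B (q (Suc i)) \<omega> - B (q i) \<omega>" for i \<omega>
  have qm: "X m \<omega> = B t \<omega> - B s \<omega>" for \<omega>
    by (simp add: X_def q_def last)
  have "indep_vars (\<lambda>_. borel) X {..<Suc m}"
    unfolding X_def
  proof (rule B_indep_increments)
    show "0 \<le> q 0" by (simp add: q_def first)
    show "q i \<le> q (Suc i)" if "i < Suc m" for i
      using that le_iff[of i "Suc i"] last st by (cases "i = m") (auto simp: q_def)
  qed
  then have ind: "indep_var (PiM {..<m} (\<lambda>_. borel)) (\<lambda>\<omega>. restrict (\<lambda>i. X i \<omega>) {..<m})
      (PiM {m} (\<lambda>_. borel)) (\<lambda>\<omega>. restrict (\<lambda>i. X i \<omega>) {m})"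
    by (rule indep_var_restrict) auto
  define U where "U = {v \<in> space (PiM {..<m} (\<lambda>_. borel :: real measure)). \<forall>r\<in>T. (\<Sum>i<k r. v i) \<in> A r}"
  have U: "U \<in> sets (PiM {..<m} (\<lambda>_. borel))"
    unfolding U_def
  proof (rule sets.sets_Collect_finite_All[OF _ T(1)])
    fix r assume r: "r \<in> T"
    have "(\<lambda>v. \<Sum>i<k r. v i) \<in> borel_measurable (PiM {..<m} (\<lambda>_. borel :: real measure))"
      using k[OF r] by (intro borel_measurable_sum measurable_component_singleton) auto
    from measurable_sets[OF this A[OF r]]
    show "{v \<in> space (PiM {..<m} (\<lambda>_. borel)). (\<Sum>i<k r. v i) \<in> A r} \<in> sets (PiM {..<m} (\<lambda>_. borel :: real measure))"
      by (simp add: vimage_def Int_def conj_commute)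
  qed
  define V where "V = {v \<in> space (PiM {m} (\<lambda>_. borel :: real measure)). v m \<in> C}"
  have V: "V \<in> sets (PiM {m} (\<lambda>_. borel))"
  proof -
    have "(\<lambda>v. v m) \<in> borel_measurable (PiM {m} (\<lambda>_. borel :: real measure))"
      by (rule measurable_component_singleton) simp
    from measurable_sets[OF this C] show ?thesis
      by (simp add: V_def vimage_def Int_def conj_commute)
  qed
  let ?D = "(\<lambda>\<omega>. B t \<omega> - B s \<omega>) -` C \<inter> space M"
  let ?E = "{\<omega> \<in> space M. \<forall>r\<in>T. B r \<omega> \<in> A r}"
  \<comment> \<open>Increments determine only \<open>B r - B 0\<close>. Since \<open>B 0\<close>
    vanishes merely almost surely, \<open>?E'\<close> agrees with \<open>?E\<close> up to a null
    event, and the two are exchanged by \<open>measure_eq_AE\<close>.\<close>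
  let ?E' = "(\<lambda>\<omega>. restrict (\<lambda>i. X i \<omega>) {..<m}) -` U \<inter> space M"
  have D: "(\<lambda>\<omega>. restrict (\<lambda>i. X i \<omega>) {m}) -` V \<inter> space M = ?D"
  proof -
    have "restrict (\<lambda>i. X i \<omega>) {m} \<in> V \<longleftrightarrow> B t \<omega> - B s \<omega> \<in> C" for \<omega>
      by (simp add: V_def space_PiM qm)
    then show ?thesis by blast
  qed
  have E': "?E' = {\<omega> \<in> space M. \<forall>r\<in>T. B r \<omega> - B 0 \<omega> \<in> A r}"
  proof -
    have "(\<Sum>i<k r. (restrict (\<lambda>i. X i \<omega>) {..<m}) i) = B r \<omega> - B 0 \<omega>" if r: "r \<in> T" for r \<omega>
    proof -
      have "(\<Sum>i<k r. (restrict (\<lambda>i. X i \<omega>) {..<m}) i) = (\<Sum>i<k r. B (q (Suc i)) \<omega> - B (q i) \<omega>)"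
        using k[OF r] by (intro sum.cong) (auto simp: X_def)
      also have "\<dots> = B (q (k r)) \<omega> - B (q 0) \<omega>" by (rule sum_lessThan_telescope)
      finally show ?thesis using k[OF r] by (simp add: q_def first)
    qed
    then have "restrict (\<lambda>i. X i \<omega>) {..<m} \<in> U \<longleftrightarrow> (\<forall>r\<in>T. B r \<omega> - B 0 \<omega> \<in> A r)" for \<omega>
      by (simp add: U_def space_PiM)
    then show ?thesis by blast
  qed
  have meas: "B r \<in> borel_measurable M" if "r \<in> T" for r
    using that T by (intro B_measurable) auto
  have cyl: "{\<omega> \<in> space M. \<forall>r\<in>T. G r \<omega> \<in> A r} \<in> events"
    if "\<And>r. r \<in> T \<Longrightarrow> G r \<in> borel_measurable M" for G :: "real \<Rightarrow> 'a \<Rightarrow> real"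
  proof (rule sets.sets_Collect_finite_All[OF _ T(1)])
    fix r assume r: "r \<in> T"
    from measurable_sets[OF that[OF r] A[OF r]]
    show "{\<omega> \<in> space M. G r \<omega> \<in> A r} \<in> events" by (simp add: vimage_def Int_def conj_commute)
  qed
  have E_ev: "?E \<in> events" by (rule cyl) (rule meas)
  have E'_ev: "?E' \<in> events"
    unfolding E' using meas B_measurable[of 0] by (intro cyl) auto
  have D_ev: "?D \<in> events"
    using B_measurable[of s] B_measurable[of t] st C by (intro measurable_sets[OF _ C]) auto
  have AE: "AE \<omega> in M. \<omega> \<in> ?E \<longleftrightarrow> \<omega> \<in> ?E'"
    using B_zero unfolding E' by eventually_elim simp
  have "prob (?E \<inter> ?D) = prob (?E' \<inter> ?D)"
    using AE E_ev E'_ev D_ev by (intro measure_eq_AE) auto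
  also have "?E' \<inter> ?D = (\<lambda>\<omega>. (restrict (\<lambda>i. X i \<omega>) {..<m}, restrict (\<lambda>i. X i \<omega>) {m})) -` (U \<times> V) \<inter> space M"
    using D by auto
  also have "prob \<dots> = prob ?E' * prob ((\<lambda>\<omega>. restrict (\<lambda>i. X i \<omega>) {m}) -` V \<inter> space M)"
    by (rule indep_varD[OF ind U V])
  also have "\<dots> = prob ?E' * prob ?D" by (simp only: D)
  also have "prob ?E' = prob ?E"
    using AE E_ev E'_ev by (intro measure_eq_AE) auto
  finally show ?thesis .
qed

text \<open>Two intersection-stable families are independent, hence so are the sigma-algebras they
  generate; the one generated by \<open>Cyl\<close> contains \<open>F s\<close>.\<close>

lemma increment_indep_past:
  assumes st: "0 \<le> s" "s < t" and X: "X \<in> borel_measurable (F s)"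
  shows "indep_var borel X borel (\<lambda>\<omega>. B t \<omega> - B s \<omega>)"
proof -
  \<comment> \<open>Null events can join the cylinders directly: meeting one with any event gives a
    null event, which preserves stability under intersection and makes both sides of the product
    formula zero.\<close>
  define Cyl where "Cyl = null_sets M \<union> {{\<omega> \<in> space M. \<forall>r\<in>T. B r \<omega> \<in> A r} | T A.
      finite T \<and> T \<subseteq> {0..s} \<and> (\<forall>r. A r \<in> sets borel)}"
  define Inc where "Inc = {(\<lambda>\<omega>. B t \<omega> - B s \<omega>) -` C \<inter> space M | C. C \<in> sets borel}"
  have Inc_meas: "(\<lambda>\<omega>. B t \<omega> - B s \<omega>) \<in> borel_measurable M"
    using B_measurable[of s] B_measurable[of t] st by auto
  have cyl: "{\<omega> \<in> space M. \<forall>r\<in>T. B r \<omega> \<in> A r} \<in> events"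
    if "finite T" "T \<subseteq> {0..s}" "\<forall>r. A r \<in> sets borel" for T A
  proof (rule sets.sets_Collect_finite_All[OF _ that(1)])
    fix r assume "r \<in> T"
    then have "B r \<in> borel_measurable M" using that by (intro B_measurable) auto
    from measurable_sets[OF this] that(3)
    show "{\<omega> \<in> space M. B r \<omega> \<in> A r} \<in> events" by (simp add: vimage_def Int_def conj_commute)
  qed
  have Cyl_ev: "Cyl \<subseteq> events"
    using cyl by (auto simp: Cyl_def)
  have "indep_set Cyl Inc"
    unfolding indep_sets2_eq
  proof (intro conjI ballI)
    show "Cyl \<subseteq> events" by fact
    show "Inc \<subseteq> events" using Inc_meas by (auto simp: Inc_def intro: measurable_sets)
    fix a d assume a: "a \<in> Cyl" and d: "d \<in> Inc"
    show "prob (a \<inter> d) = prob a * prob d"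
    proof (cases "a \<in> null_sets M")
      case True
      then have "a \<inter> d \<in> null_sets M"
        using \<open>Inc \<subseteq> events\<close> d by (auto intro: null_set_Int2)
      then show ?thesis using True by (simp add: measure_eq_0_null_sets)
    next
      case False
      then show ?thesis using a d cylinder_indep_increment[OF _ _ _ st]
        by (auto simp: Cyl_def Inc_def)
    qed
  qed
  moreover have "Int_stable Cyl"
  proof (rule Int_stableI)
    fix a c assume ac: "a \<in> Cyl" "c \<in> Cyl"
    show "a \<inter> c \<in> Cyl"
    proof (cases "a \<in> null_sets M \<or> c \<in> null_sets M")
      case True
      then have "a \<inter> c \<in> null_sets M"
        using Cyl_ev ac by (auto intro: null_set_Int1 null_set_Int2)
      then show ?thesis by (simp add: Cyl_def)
    next
      case False
      then obtain T A T' A' where T: "a = {\<omega> \<in> space M. \<forall>r\<in>T. B r \<omega> \<in> A r}"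
          "finite T" "T \<subseteq> {0..s}" "\<forall>r. A r \<in> sets borel"
        and T': "c = {\<omega> \<in> space M. \<forall>r\<in>T'. B r \<omega> \<in> A' r}"
          "finite T'" "T' \<subseteq> {0..s}" "\<forall>r. A' r \<in> sets borel"
        using ac unfolding Cyl_def by auto
      \<comment> \<open>Padding with \<open>UNIV\<close> lets two cylinders over different time sets
        be written as one over the union.\<close>
      let ?A = "\<lambda>r. (if r \<in> T then A r else UNIV) \<inter> (if r \<in> T' then A' r else UNIV)"
      have "a \<inter> c = {\<omega> \<in> space M. \<forall>r\<in>T \<union> T'. B r \<omega> \<in> ?A r}"
        unfolding T(1) T'(1) by (auto split: if_splits)
      moreover have "finite (T \<union> T')" "T \<union> T' \<subseteq> {0..s}" "\<forall>r. ?A r \<in> sets borel"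
        using T T' by auto
      ultimately show ?thesis
        unfolding Cyl_def by (intro UnI2 CollectI exI[of _ "T \<union> T'"] exI[of _ ?A] conjI)
    qed
  qed
  moreover have "Int_stable Inc"
  proof (rule Int_stableI)
    fix a c assume "a \<in> Inc" "c \<in> Inc"
    then obtain C C' where "C \<in> sets borel" "C' \<in> sets borel"
      "a = (\<lambda>\<omega>. B t \<omega> - B s \<omega>) -` C \<inter> space M" "c = (\<lambda>\<omega>. B t \<omega> - B s \<omega>) -` C' \<inter> space M"
      by (auto simp: Inc_def)
    then show "a \<inter> c \<in> Inc" unfolding Inc_def by (intro CollectI exI[of _ "C \<inter> C'"]) auto
  qed
  ultimately have indep: "indep_set (sigma_sets (space M) Cyl) (sigma_sets (space M) Inc)"
    by (rule indep_set_sigma_sets)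
  have sub: "sets (F s) \<subseteq> sigma_sets (space M) Cyl"
    unfolding sets_F
  proof (rule sigma_sets_mono', safe)
    show "a \<in> Cyl" if "a \<in> null_sets M" for a using that by (simp add: Cyl_def)
    fix r and A :: "real set" assume r: "0 \<le> r" "r \<le> s" "A \<in> sets borel"
    have "B r -` A \<inter> space M = {\<omega> \<in> space M. \<forall>r'\<in>{r}. B r' \<omega> \<in> (\<lambda>_. A) r'}" by auto
    moreover have "finite {r}" "{r} \<subseteq> {0..s}" "\<forall>r'. (\<lambda>_. A) r' \<in> sets borel" using r by auto
    ultimately show "B r -` A \<inter> space M \<in> Cyl"
      unfolding Cyl_def by (intro UnI2 CollectI exI[of _ "{r}"] exI[of _ "\<lambda>_. A"] conjI)
  qed
  have "X -` A \<inter> space M \<in> sigma_sets (space M) Cyl" if "A \<in> sets borel" for A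
    using measurable_sets[OF X that] sub by auto
  then have "sigma_sets (space M) {X -` A \<inter> space M | A. A \<in> sets borel} \<subseteq> sigma_sets (space M) Cyl"
    by (intro sigma_sets_mono) auto
  then have "indep_set (sigma_sets (space M) {X -` A \<inter> space M | A. A \<in> sets borel}) (sigma_sets (space M) Inc)"
    using indep unfolding indep_sets2_eq by blast
  then show ?thesis
    unfolding indep_var_eq Inc_def using measurable_F_imp[OF X] Inc_meas by simp
qed

lemma increment_moments:
  assumes st: "0 \<le> s" "s < t"
  shows "integrable M (\<lambda>\<omega>. B t \<omega> - B s \<omega>)" "expectation (\<lambda>\<omega>. B t \<omega> - B s \<omega>) = 0"
    and "integrable M (\<lambda>\<omega>. (B t \<omega> - B s \<omega>)\<^sup>2)" "expectation (\<lambda>\<omega>. (B t \<omega> - B s \<omega>)\<^sup>2) = t - s"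
proof -
  have pos: "0 < sqrt (t - s)" using st by simp
  note D = B_increment_normal[OF st]
  show "integrable M (\<lambda>\<omega>. B t \<omega> - B s \<omega>)"
    using distributed_integrable[OF D, of "\<lambda>x. x"] integrable_normal_moment[OF pos, of 0 1] by simp
  show e: "expectation (\<lambda>\<omega>. B t \<omega> - B s \<omega>) = 0"
    by (rule normal_distributed_expectation[OF pos D])
  show "integrable M (\<lambda>\<omega>. (B t \<omega> - B s \<omega>)\<^sup>2)"
    using distributed_integrable[OF D, of "\<lambda>x. x\<^sup>2"] integrable_normal_moment[OF pos, of 0 2] by simp
  show "expectation (\<lambda>\<omega>. (B t \<omega> - B s \<omega>)\<^sup>2) = t - s"
    using normal_distributed_variance[OF pos D] st unfolding e by simp
qed

end

section \<open>Ito isometry and tail bound for elementary integrals\<close>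

context brownian_motion begin

lemma elementary_integral_measurable:
  assumes p: "0 \<le> p 0" "\<And>i. i < n \<Longrightarrow> p i \<le> p (Suc i)"
    and \<eta>: "\<And>i. i < n \<Longrightarrow> \<eta> i \<in> borel_measurable (F (p i))"
  shows "(\<lambda>\<omega>. \<Sum>i<n. \<eta> i \<omega> * (B (p (Suc i)) \<omega> - B (p i) \<omega>)) \<in> borel_measurable (F (p n))"
proof (rule borel_measurable_sum)
  fix i assume i: "i \<in> {..<n}"
  note mono = steps_mono[of n p, OF p(2)]
  have "0 \<le> p i" "p i \<le> p (Suc i)" "p (Suc i) \<le> p n" "p i \<le> p n"
    using mono[of 0 i] mono[of i "Suc i"] mono[of "Suc i" n] mono[of i n] p(1) i by auto
  then have "\<eta> i \<in> borel_measurable (F (p n))" "B (p (Suc i)) \<in> borel_measurable (F (p n))"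
      "B (p i) \<in> borel_measurable (F (p n))"
    using measurable_F_mono[OF _ \<eta>, of i "p n"] B_measurable_F i by auto
  then show "(\<lambda>\<omega>. \<eta> i \<omega> * (B (p (Suc i)) \<omega> - B (p i) \<omega>)) \<in> borel_measurable (F (p n))"
    by simp
qed

text \<open>Induction on the number of cells. The last increment \<open>D\<close> is independent of
  the past, so the cross term factors and vanishes with the mean of \<open>D\<close>, while the
  square term factors into the second moment of \<open>\<eta> n\<close> and the variance of
  \<open>D\<close>.\<close>

lemma ito_isometry_elementary:
  assumes p: "0 \<le> p 0" "\<And>i. i < n \<Longrightarrow> p i \<le> p (Suc i)"
    and \<eta>: "\<And>i. i < n \<Longrightarrow> \<eta> i \<in> borel_measurable (F (p i))"
    and bdd: "\<And>i. i < n \<Longrightarrow> \<exists>C. \<forall>\<omega>\<in>space M. \<bar>\<eta> i \<omega>\<bar> \<le> C"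
  shows "integrable M (\<lambda>\<omega>. (\<Sum>i<n. \<eta> i \<omega> * (B (p (Suc i)) \<omega> - B (p i) \<omega>))\<^sup>2) \<and>
    expectation (\<lambda>\<omega>. (\<Sum>i<n. \<eta> i \<omega> * (B (p (Suc i)) \<omega> - B (p i) \<omega>))\<^sup>2) =
      (\<Sum>i<n. expectation (\<lambda>\<omega>. (\<eta> i \<omega>)\<^sup>2) * (p (Suc i) - p i))"
  using p(2) \<eta> bdd
proof (induction n)
  case 0
  show ?case by simp
next
  case (Suc n)
  define S where "S \<omega> = (\<Sum>i<n. \<eta> i \<omega> * (B (p (Suc i)) \<omega> - B (p i) \<omega>))" for \<omega>
  define D where "D \<omega> = B (p (Suc n)) \<omega> - B (p n) \<omega>" for \<omega>
  have IH: "integrable M (\<lambda>\<omega>. (S \<omega>)\<^sup>2)"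
      "expectation (\<lambda>\<omega>. (S \<omega>)\<^sup>2) = (\<Sum>i<n. expectation (\<lambda>\<omega>. (\<eta> i \<omega>)\<^sup>2) * (p (Suc i) - p i))"
    using Suc.IH Suc.prems unfolding S_def by auto
  \<comment> \<open>A cell of length zero adds nothing to either side; it is separated because the
    normal law is given only for increments over intervals of positive length.\<close>
  show ?case
  proof (cases "p n = p (Suc n)")
    case True
    then show ?thesis using IH unfolding S_def by simp
  next
    case False
    have lt: "p n < p (Suc n)" using False Suc.prems(1)[of n] by simp
    have pos: "0 \<le> p n"
      using steps_mono[of "Suc n" p 0 n] Suc.prems(1) p(1) by simp
    note D = increment_moments[OF pos lt, folded D_def]
    have S_meas: "S \<in> borel_measurable (F (p n))"
      unfolding S_def using Suc.prems p(1) by (intro elementary_integral_measurable) auto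
    have \<eta>_meas: "\<eta> n \<in> borel_measurable (F (p n))" using Suc.prems by simp
    note meas [measurable] = measurable_F_imp[OF S_meas] measurable_F_imp[OF \<eta>_meas]
    have S_int: "integrable M S"
      by (rule square_integrable_imp_integrable[OF meas(1) IH(1)])
    obtain C where "\<forall>\<omega>\<in>space M. \<bar>\<eta> n \<omega>\<bar> \<le> C"
      using Suc.prems(3)[of n] by blast
    then have C: "\<bar>\<eta> n \<omega>\<bar> \<le> C" if "\<omega> \<in> space M" for \<omega>
      using that by blast
    \<comment> \<open>Integrability of the cross factor comes from boundedness of
      \<open>\<eta> n\<close>: the product is dominated by a multiple of \<open>S\<close>.\<close>
    have S\<eta>: "integrable M (\<lambda>\<omega>. S \<omega> * \<eta> n \<omega>)"
    proof (rule Bochner_Integration.integrable_bound)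
      show "integrable M (\<lambda>\<omega>. C * S \<omega>)" using S_int by simp
      show "AE \<omega> in M. norm (S \<omega> * \<eta> n \<omega>) \<le> norm (C * S \<omega>)"
      proof (rule AE_I2)
        fix \<omega> assume "\<omega> \<in> space M"
        from mult_right_mono[OF C[OF this], of "\<bar>S \<omega>\<bar>"]
        show "norm (S \<omega> * \<eta> n \<omega>) \<le> norm (C * S \<omega>)"
          using mult_right_mono[OF abs_ge_self, of "\<bar>S \<omega>\<bar>" C] by (simp add: abs_mult mult.commute)
      qed
    qed simp
    have \<eta>2: "integrable M (\<lambda>\<omega>. (\<eta> n \<omega>)\<^sup>2)"
    proof (rule integrable_const_bound[where B="C\<^sup>2"])
      show "AE \<omega> in M. norm ((\<eta> n \<omega>)\<^sup>2) \<le> C\<^sup>2"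
        using C by (intro AE_I2) (metis abs_ge_zero norm_power power_mono real_norm_def)
    qed simp
    have ind1: "indep_var borel (\<lambda>\<omega>. S \<omega> * \<eta> n \<omega>) borel D"
      using increment_indep_past[OF pos lt, folded D_def] S_meas \<eta>_meas by simp
    have "indep_var borel (\<eta> n) borel D"
      using increment_indep_past[OF pos lt, folded D_def] \<eta>_meas by simp
    then have "indep_var borel ((\<lambda>x. x\<^sup>2) \<circ> \<eta> n) borel ((\<lambda>x. x\<^sup>2) \<circ> D)"
      by (rule indep_var_compose) auto
    then have ind2: "indep_var borel (\<lambda>\<omega>. (\<eta> n \<omega>)\<^sup>2) borel (\<lambda>\<omega>. (D \<omega>)\<^sup>2)"
      by (simp add: comp_def)
    have sq: "(S \<omega> + \<eta> n \<omega> * D \<omega>)\<^sup>2 = (S \<omega>)\<^sup>2 + 2 * ((S \<omega> * \<eta> n \<omega>) * D \<omega>) + (\<eta> n \<omega>)\<^sup>2 * (D \<omega>)\<^sup>2" for \<omega>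
      by (simp add: power2_eq_square algebra_simps)
    note int = IH(1) indep_var_integrable[OF ind1 S\<eta> D(1)] indep_var_integrable[OF ind2 \<eta>2 D(3)]
    have "integrable M (\<lambda>\<omega>. (S \<omega> + \<eta> n \<omega> * D \<omega>)\<^sup>2)"
      unfolding sq using int by (intro Bochner_Integration.integrable_add integrable_mult_right) auto
    moreover have "expectation (\<lambda>\<omega>. (S \<omega> + \<eta> n \<omega> * D \<omega>)\<^sup>2) =
        expectation (\<lambda>\<omega>. (S \<omega>)\<^sup>2) + expectation (\<lambda>\<omega>. (\<eta> n \<omega>)\<^sup>2) * (p (Suc n) - p n)"
      unfolding sq using int indep_var_lebesgue_integral[OF ind1 S\<eta> D(1)]
        indep_var_lebesgue_integral[OF ind2 \<eta>2 D(3)] D by simp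
    ultimately show ?thesis using IH(2) by (simp add: S_def D_def)
  qed
qed

text \<open>The integrand is truncated before its accumulated variance exceeds \<open>\<delta>\<close>, which is decided by
  the left endpoint of each cell, so that the isometry applies to the truncation.\<close>

lemma elementary_integral_tail:
  assumes p: "0 \<le> p 0" "\<And>i. i < n \<Longrightarrow> p i \<le> p (Suc i)"
    and \<eta>: "\<And>i. i < n \<Longrightarrow> \<eta> i \<in> borel_measurable (F (p i))"
    and bdd: "\<And>i. i < n \<Longrightarrow> \<exists>C. \<forall>\<omega>\<in>space M. \<bar>\<eta> i \<omega>\<bar> \<le> C"
    and pos: "\<epsilon> > 0" "\<delta> \<ge> 0"
  shows "prob {\<omega> \<in> space M. \<bar>\<Sum>i<n. \<eta> i \<omega> * (B (p (Suc i)) \<omega> - B (p i) \<omega>)\<bar> > \<epsilon>}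
    \<le> prob {\<omega> \<in> space M. (\<Sum>i<n. (\<eta> i \<omega>)\<^sup>2 * (p (Suc i) - p i)) > \<delta>} + \<delta> / \<epsilon>\<^sup>2"
proof -
  define V where "V j \<omega> = (\<Sum>i<j. (\<eta> i \<omega>)\<^sup>2 * (p (Suc i) - p i))" for j \<omega>
  \<comment> \<open>The test uses \<open>Suc i\<close> because cell \<open>i\<close> itself must be
    counted: with \<open>V i\<close> the last retained cell could overshoot \<delta>. It is still
    decided at time \<open>p i\<close>, since the cell width is deterministic and
    \<open>\<eta> i\<close> is known there.\<close>
  define \<eta>' where "\<eta>' i \<omega> = (if V (Suc i) \<omega> \<le> \<delta> then \<eta> i \<omega> else 0)" for i \<omega>
  define S where "S \<omega> = (\<Sum>i<n. \<eta> i \<omega> * (B (p (Suc i)) \<omega> - B (p i) \<omega>))" for \<omega>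
  define S' where "S' \<omega> = (\<Sum>i<n. \<eta>' i \<omega> * (B (p (Suc i)) \<omega> - B (p i) \<omega>))" for \<omega>
  note mono = steps_mono[of n p, OF p(2)]
  have V_mono: "V j \<omega> \<le> V k \<omega>" if "j \<le> k" "k \<le> n" for j k \<omega>
    unfolding V_def using that p by (intro sum_mono2) auto
  have V_meas: "V j \<in> borel_measurable (F (p i))" if "j \<le> Suc i" "i < n" for i j
    unfolding V_def
  proof (rule borel_measurable_sum)
    fix k assume "k \<in> {..<j}"
    then have "\<eta> k \<in> borel_measurable (F (p i))"
      using measurable_F_mono[OF mono \<eta>, of k i] that by auto
    then show "(\<lambda>\<omega>. (\<eta> k \<omega>)\<^sup>2 * (p (Suc k) - p k)) \<in> borel_measurable (F (p i))" by simp
  qed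
  have \<eta>'_meas: "\<eta>' i \<in> borel_measurable (F (p i))" if "i < n" for i
  proof -
    note [measurable] = \<eta>[OF that] V_meas[OF order_refl that]
    show ?thesis unfolding \<eta>'_def by measurable
  qed
  have \<eta>'_bdd: "\<exists>C. \<forall>\<omega>\<in>space M. \<bar>\<eta>' i \<omega>\<bar> \<le> C" if i: "i < n" for i
  proof -
    obtain C where "\<forall>\<omega>\<in>space M. \<bar>\<eta> i \<omega>\<bar> \<le> C" using bdd[OF i] by blast
    then have "\<forall>\<omega>\<in>space M. \<bar>\<eta>' i \<omega>\<bar> \<le> max C 0" by (auto simp: \<eta>'_def)
    then show ?thesis by blast
  qed
  \<comment> \<open>Either the last cell is retained, and then the sum is at most
    \<open>V (Suc j)\<close>, which passed the test, or it is cut and the sum does not grow.\<close>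
  have V'_le: "(\<Sum>i<j. (\<eta>' i \<omega>)\<^sup>2 * (p (Suc i) - p i)) \<le> \<delta>" if "j \<le> n" for j \<omega>
    using that
  proof (induction j)
    case 0
    show ?case using pos by simp
  next
    case (Suc j)
    show ?case
    proof (cases "V (Suc j) \<omega> \<le> \<delta>")
      case True
      have "(\<Sum>i<Suc j. (\<eta>' i \<omega>)\<^sup>2 * (p (Suc i) - p i)) \<le> V (Suc j) \<omega>"
        unfolding V_def using p Suc.prems by (intro sum_mono mult_right_mono) (auto simp: \<eta>'_def)
      then show ?thesis using True by linarith
    next
      case False
      then show ?thesis using Suc by (simp add: \<eta>'_def)
    qed
  qed
  note iso = ito_isometry_elementary[of p n, OF p \<eta>'_meas \<eta>'_bdd, folded S'_def]
  have \<eta>'_int: "integrable M (\<lambda>\<omega>. (\<eta>' i \<omega>)\<^sup>2)" if i: "i < n" for i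
  proof -
    obtain C where C: "\<forall>\<omega>\<in>space M. \<bar>\<eta>' i \<omega>\<bar> \<le> C" using \<eta>'_bdd[OF i] by blast
    note [measurable] = measurable_F_imp[OF \<eta>'_meas[OF i]]
    show ?thesis
    proof (rule integrable_const_bound[where B="C\<^sup>2"])
      show "AE \<omega> in M. norm ((\<eta>' i \<omega>)\<^sup>2) \<le> C\<^sup>2"
        using C by (intro AE_I2) (metis abs_ge_zero norm_power power_mono real_norm_def)
    qed simp
  qed
  have "expectation (\<lambda>\<omega>. (S' \<omega>)\<^sup>2) = expectation (\<lambda>\<omega>. \<Sum>i<n. (\<eta>' i \<omega>)\<^sup>2 * (p (Suc i) - p i))"
    using iso \<eta>'_int by (subst Bochner_Integration.integral_sum) auto
  also have "\<dots> \<le> expectation (\<lambda>\<omega>. \<delta>)"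
    using V'_le \<eta>'_int by (intro integral_mono Bochner_Integration.integrable_sum integrable_mult_left) auto
  finally have E: "expectation (\<lambda>\<omega>. (S' \<omega>)\<^sup>2) \<le> \<delta>" by (simp add: prob_space)
  have S_meas [measurable]: "S \<in> borel_measurable M" "S' \<in> borel_measurable M"
    unfolding S_def S'_def
    using elementary_integral_measurable[OF p \<eta>, THEN measurable_F_imp]
      elementary_integral_measurable[OF p \<eta>'_meas, THEN measurable_F_imp] by auto
  have [measurable]: "V n \<in> borel_measurable M"
  proof -
    have "(\<lambda>\<omega>. (\<eta> i \<omega>)\<^sup>2 * (p (Suc i) - p i)) \<in> borel_measurable M" if "i < n" for i
      using measurable_F_imp[OF \<eta>[OF that]] by simp
    then show ?thesis unfolding V_def by (intro borel_measurable_sum) auto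
  qed
  have "prob {\<omega> \<in> space M. \<epsilon>\<^sup>2 \<le> (S' \<omega>)\<^sup>2} \<le> expectation (\<lambda>\<omega>. (S' \<omega>)\<^sup>2) / \<epsilon>\<^sup>2"
    using iso pos by (intro integral_Markov_inequality_measure[where A="space M"]) auto
  also have "\<dots> \<le> \<delta> / \<epsilon>\<^sup>2" using E by (intro divide_right_mono) auto
  finally have Markov: "prob {\<omega> \<in> space M. \<epsilon>\<^sup>2 \<le> (S' \<omega>)\<^sup>2} \<le> \<delta> / \<epsilon>\<^sup>2" .
  \<comment> \<open>Where the total variance stays within \<delta>, monotonicity of \<open>V\<close>
    means that no cell was cut, so \<open>S\<close> and \<open>S'\<close> coincide.\<close>
  have "{\<omega> \<in> space M. \<bar>S \<omega>\<bar> > \<epsilon>} \<subseteq> {\<omega> \<in> space M. V n \<omega> > \<delta>} \<union> {\<omega> \<in> space M. \<epsilon>\<^sup>2 \<le> (S' \<omega>)\<^sup>2}"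
  proof
    fix \<omega> assume \<omega>: "\<omega> \<in> {\<omega> \<in> space M. \<bar>S \<omega>\<bar> > \<epsilon>}"
    have "S' \<omega> = S \<omega>" if "V n \<omega> \<le> \<delta>"
    proof -
      have "V (Suc i) \<omega> \<le> \<delta>" if "i < n" for i
        using V_mono[of "Suc i" n \<omega>] that \<open>V n \<omega> \<le> \<delta>\<close> by simp
      then show ?thesis unfolding S_def S'_def by (intro sum.cong) (auto simp: \<eta>'_def)
    qed
    moreover have "\<epsilon>\<^sup>2 \<le> (S \<omega>)\<^sup>2"
      using \<omega> pos by (subst abs_le_square_iff[symmetric]) auto
    ultimately show "\<omega> \<in> {\<omega> \<in> space M. V n \<omega> > \<delta>} \<union> {\<omega> \<in> space M. \<epsilon>\<^sup>2 \<le> (S' \<omega>)\<^sup>2}"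
      using \<omega> by force
  qed
  then have "prob {\<omega> \<in> space M. \<bar>S \<omega>\<bar> > \<epsilon>} \<le>
      prob ({\<omega> \<in> space M. V n \<omega> > \<delta>} \<union> {\<omega> \<in> space M. \<epsilon>\<^sup>2 \<le> (S' \<omega>)\<^sup>2})"
    by (intro finite_measure_mono) auto
  also have "\<dots> \<le> prob {\<omega> \<in> space M. V n \<omega> > \<delta>} + prob {\<omega> \<in> space M. \<epsilon>\<^sup>2 \<le> (S' \<omega>)\<^sup>2}"
    by (intro measure_Un_le) auto
  finally show ?thesis using Markov unfolding S_def V_def by linarith
qed

end

section \<open>Simple processes rewritten on a refining grid\<close>

context time_grid begin

text \<open>A breakpoint \<open>x\<close> below \<open>s\<close> is not affected by the cap at t,
  hence is a grid point, and no grid index lies strictly between \<open>j\<close> and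
  \<open>Suc j\<close>. The cap is there because the partition of a simple integrand may run past
  t.\<close>

lemma less_cell_iff:
  assumes x: "min x t \<in> p ` {..m}" and j: "j < m" and s: "p j < s" "s \<le> p (Suc j)"
  shows "x < s \<longleftrightarrow> x \<le> p j"
proof
  assume "x < s"
  obtain a where a: "a \<le> m" "min x t = p a" using x by auto
  have "s \<le> t" using s bounds[of "Suc j"] j by simp
  then have "x = p a" using a \<open>x < s\<close> by simp
  then have "p a < p (Suc j)" using \<open>x < s\<close> s by simp
  then have "a \<le> j" using less_iff[of a "Suc j"] a j by simp
  then show "x \<le> p j" using le_iff[of a j] a j \<open>x = p a\<close> by simp
qed (use s in simp)

text \<open>The cells ending no later than \<open>x\<close> are exactly an initial block, so the
  selected sum telescopes. Writing the selection with \<open>of_bool\<close> keeps the range of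
  summation independent of \<open>x\<close>, and sums for different breakpoints can be subtracted
  term by term.\<close>

lemma telescope:
  fixes f :: "real \<Rightarrow> real"
  assumes "min x t \<in> p ` {..m}"
  shows "f (min x t) - f 0 = (\<Sum>j<m. of_bool (p (Suc j) \<le> x) * (f (p (Suc j)) - f (p j)))"
proof -
  obtain a where a: "a \<le> m" "min x t = p a" using assms by auto
  have iff: "p (Suc j) \<le> x \<longleftrightarrow> j < a" if "j < m" for j
    using le_iff[of "Suc j" a] bounds[of "Suc j"] that a by (auto simp: Suc_le_eq min_def split: if_splits)
  have "(\<Sum>j<m. of_bool (p (Suc j) \<le> x) * (f (p (Suc j)) - f (p j))) =
      (\<Sum>j<m. if j < a then f (p (Suc j)) - f (p j) else 0)"
    using iff by (intro sum.cong) auto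
  also have "\<dots> = (\<Sum>j<a. f (p (Suc j)) - f (p j))"
    using a(1) by (intro sum.mono_neutral_cong_right) auto
  also have "\<dots> = f (p a) - f (p 0)" by (rule sum_lessThan_telescope)
  finally show ?thesis by (simp add: a(2) first)
qed

lemma simple_process_cell:
  assumes "\<And>i. i \<le> n \<Longrightarrow> min (\<tau> i) t \<in> p ` {..m}" "j < m" "p j < s" "s \<le> p (Suc j)"
  shows "simple_process n \<tau> \<xi> s \<omega> = simple_process n \<tau> \<xi> (p (Suc j)) \<omega>"
proof -
  have "\<tau> i < s \<longleftrightarrow> \<tau> i < p (Suc j)" if "i \<le> n" for i
    using less_cell_iff[OF assms(1)[OF that] assms(2)] assms(3,4) by (meson order.refl order_less_le_trans)
  then show ?thesis
    unfolding simple_process_def by (intro sum.cong) (auto simp: indicator_def not_less[symmetric])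
qed

text \<open>Each increment of \<open>B\<close> over a partition interval splits into grid
  increments; after exchanging the two sums, the coefficient of a grid increment is the value of the
  process at the right end of that cell. Two integrals on the same grid then differ by an elementary
  integral.\<close>

lemma simple_ito_integral_eq:
  assumes "\<And>i. i \<le> n \<Longrightarrow> min (\<tau> i) t \<in> p ` {..m}" "\<And>i. i < n \<Longrightarrow> \<tau> i \<le> \<tau> (Suc i)"
  shows "simple_ito_integral B n \<tau> \<xi> t \<omega> =
    (\<Sum>j<m. simple_process n \<tau> \<xi> (p (Suc j)) \<omega> * (B (p (Suc j)) \<omega> - B (p j) \<omega>))"
proof -
  have "\<xi> i \<omega> * (B (min (\<tau> (Suc i)) t) \<omega> - B (min (\<tau> i) t) \<omega>) =
      (\<Sum>j<m. \<xi> i \<omega> * indicator {\<tau> i<..\<tau> (Suc i)} (p (Suc j)) * (B (p (Suc j)) \<omega> - B (p j) \<omega>))"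
    if i: "i < n" for i
  proof -
    \<comment> \<open>In this form the claim is the difference of two instances of
      \<open>telescope\<close>, and the term \<open>f 0\<close> cancels.\<close>
    have ind: "indicator {\<tau> i<..\<tau> (Suc i)} y = of_bool (y \<le> \<tau> (Suc i)) - (of_bool (y \<le> \<tau> i) :: real)" for y
      using assms(2)[OF i] by (auto simp: indicator_def)
    have "B (min (\<tau> (Suc i)) t) \<omega> - B (min (\<tau> i) t) \<omega> =
        (\<Sum>j<m. indicator {\<tau> i<..\<tau> (Suc i)} (p (Suc j)) * (B (p (Suc j)) \<omega> - B (p j) \<omega>))"
      using telescope[of "\<tau> (Suc i)" "\<lambda>s. B s \<omega>"] telescope[of "\<tau> i" "\<lambda>s. B s \<omega>"] assms(1) i
      by (simp add: ind left_diff_distrib sum_subtractf)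
    then show ?thesis by (simp only: sum_distrib_left mult.assoc)
  qed
  then have "simple_ito_integral B n \<tau> \<xi> t \<omega> =
      (\<Sum>i<n. \<Sum>j<m. \<xi> i \<omega> * indicator {\<tau> i<..\<tau> (Suc i)} (p (Suc j)) * (B (p (Suc j)) \<omega> - B (p j) \<omega>))"
    unfolding simple_ito_integral_def by (intro sum.cong) auto
  also have "\<dots> = (\<Sum>j<m. simple_process n \<tau> \<xi> (p (Suc j)) \<omega> * (B (p (Suc j)) \<omega> - B (p j) \<omega>))"
    unfolding simple_process_def sum_distrib_right by (rule sum.swap)
  finally show ?thesis .
qed

lemma sum_indicator_cells:
  "(\<Sum>j<m. indicator {p j<..p (Suc j)} s) = (indicator {0<..t} s :: real)"
proof -
  have "(\<Sum>j<k. indicator {p j<..p (Suc j)} s) = (indicator {p 0<..p k} s :: real)" if "k \<le> m" for k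
    using that
  proof (induction k)
    case (Suc k)
    then have "p 0 \<le> p k" "p k \<le> p (Suc k)" using le_iff by auto
    then show ?case using Suc by (auto simp: indicator_def)
  qed simp
  then show ?thesis by (simp add: first last)
qed

text \<open>The cells are open on the left and miss time 0; with \<open>g 0 = 0\<close> the
  decomposition into cell indicators holds at every point.\<close>

lemma step_function_integral:
  fixes g :: "real \<Rightarrow> real"
  assumes g: "\<And>j s. j < m \<Longrightarrow> p j < s \<Longrightarrow> s \<le> p (Suc j) \<Longrightarrow> g s = g (p (Suc j))" and "g 0 = 0"
  shows "(LBINT s:{0..t}. g s) = (\<Sum>j<m. g (p (Suc j)) * (p (Suc j) - p j))"
proof -
  have "indicator {0..t} s * g s = (\<Sum>j<m. g (p (Suc j)) * indicator {p j<..p (Suc j)} s)" for s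
  proof -
    have "indicator {0..t} s * g s = g s * indicator {0<..t} s"
      using \<open>g 0 = 0\<close> by (cases "s = 0") (auto simp: indicator_def)
    also have "\<dots> = (\<Sum>j<m. g s * indicator {p j<..p (Suc j)} s)"
      by (simp add: sum_indicator_cells[symmetric] sum_distrib_left)
    also have "\<dots> = (\<Sum>j<m. g (p (Suc j)) * indicator {p j<..p (Suc j)} s)"
    proof (rule sum.cong[OF refl])
      fix j assume "j \<in> {..<m}"
      then show "g s * indicator {p j<..p (Suc j)} s = g (p (Suc j)) * indicator {p j<..p (Suc j)} s"
        using g[of j s] by (cases "s \<in> {p j<..p (Suc j)}") simp_all
    qed
    finally show ?thesis .
  qed
  then have "(LBINT s:{0..t}. g s) = (\<integral>s. (\<Sum>j<m. g (p (Suc j)) * indicator {p j<..p (Suc j)} s) \<partial>lborel)"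
    unfolding set_lebesgue_integral_def by simp
  also have "\<dots> = (\<Sum>j<m. \<integral>s. g (p (Suc j)) * indicator {p j<..p (Suc j)} s \<partial>lborel)"
    using le_iff by (intro Bochner_Integration.integral_sum integrable_mult_right integrable_real_indicator) simp_all
  also have "\<dots> = (\<Sum>j<m. g (p (Suc j)) * (p (Suc j) - p j))"
  proof (rule sum.cong[OF refl])
    fix j assume "j \<in> {..<m}"
    then have "p j \<le> p (Suc j)" using le_iff by simp
    then show "(\<integral>s. g (p (Suc j)) * indicator {p j<..p (Suc j)} s \<partial>lborel) = g (p (Suc j)) * (p (Suc j) - p j)"
      by (subst integral_mult_right_zero) simp
  qed
  finally show ?thesis .
qed

end

lemma simple_process_zero:
  assumes \<tau>: "0 \<le> \<tau> 0" "\<And>i. i < n \<Longrightarrow> \<tau> i \<le> \<tau> (Suc i)"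
  shows "simple_process n \<tau> \<xi> 0 \<omega> = 0"
proof -
  have "0 \<le> \<tau> i" if "i \<le> n" for i
    using steps_mono[of n \<tau> 0 i, OF \<tau>(2)] \<tau>(1) that by simp
  then show ?thesis unfolding simple_process_def by (intro sum.neutral) (auto simp: indicator_def not_less)
qed

context brownian_motion begin

text \<open>On a common grid the difference of the integrals is elementary with coefficients
  \<open>\<eta> j\<close>, and the squared \<open>L\<^sup>2\<close> distance of the integrands is
  exactly its accumulated variance, so \<open>elementary_integral_tail\<close> applies. The same
  finite sum shows that this distance is a random variable.\<close>

lemma simple_ito_integral_diff_tail:
  assumes \<phi>: "simple_integrand F n \<tau> \<xi>" and \<psi>: "simple_integrand F n' \<tau>' \<xi>'"
    and t: "0 \<le> t" and pos: "\<epsilon> > 0" "\<delta> \<ge> 0"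
  shows "prob {\<omega> \<in> space M. \<bar>simple_ito_integral B n \<tau> \<xi> t \<omega> - simple_ito_integral B n' \<tau>' \<xi>' t \<omega>\<bar> > \<epsilon>}
    \<le> prob {\<omega> \<in> space M. (LBINT s:{0..t}. (simple_process n \<tau> \<xi> s \<omega> - simple_process n' \<tau>' \<xi>' s \<omega>)\<^sup>2) > \<delta>}
      + \<delta> / \<epsilon>\<^sup>2" (is "prob ?L \<le> prob ?R + _")
    and "(\<lambda>\<omega>. LBINT s:{0..t}. (simple_process n \<tau> \<xi> s \<omega> - simple_process n' \<tau>' \<xi>' s \<omega>)\<^sup>2) \<in> borel_measurable M"
      (is "?meas")
proof -
  let ?P = "{0, t} \<union> (\<lambda>i. min (\<tau> i) t) ` {..n} \<union> (\<lambda>i. min (\<tau>' i) t) ` {..n'}"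
  have nonneg: "0 \<le> \<tau> i" if "i \<le> n" "simple_integrand F n \<tau> \<xi>" for i n \<tau> \<xi>
    using steps_mono[of n \<tau> 0 i] that by (auto simp: simple_integrand_def)
  have "?P \<subseteq> {0..t}" using t nonneg[OF _ \<phi>] nonneg[OF _ \<psi>] by auto
  then obtain p m where "time_grid p m t" and p: "p ` {..m} = ?P"
    by (rule time_grid_exists[of ?P t, rotated]) auto
  then interpret time_grid p m t by simp
  have contains: "min (\<tau> i) t \<in> p ` {..m}" if "i \<le> n" for i using that p by blast
  have contains': "min (\<tau>' i) t \<in> p ` {..m}" if "i \<le> n'" for i using that p by blast
  have meas: "simple_process n \<tau> \<xi> (p (Suc j)) \<in> borel_measurable (F (p j))"
      and bdd: "\<exists>C. \<forall>\<omega>\<in>space M. \<bar>simple_process n \<tau> \<xi> (p (Suc j)) \<omega>\<bar> \<le> C"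
    if j: "j < m" and int: "simple_integrand F n \<tau> \<xi>"
      and c: "\<And>i. i \<le> n \<Longrightarrow> min (\<tau> i) t \<in> p ` {..m}" for j n \<tau> \<xi>
  proof -
    show "simple_process n \<tau> \<xi> (p (Suc j)) \<in> borel_measurable (F (p j))"
      unfolding simple_process_def[abs_def]
    proof (rule borel_measurable_sum)
      fix i assume i: "i \<in> {..<n}"
      show "(\<lambda>\<omega>. \<xi> i \<omega> * indicator {\<tau> i<..\<tau> (Suc i)} (p (Suc j))) \<in> borel_measurable (F (p j))"
      \<comment> \<open>The process is evaluated at the right end of the cell, yet it is known at
        the left end: a term with a nonzero indicator starts before \<open>p (Suc j)\<close>, hence
        by \<open>p j\<close> at the latest.\<close>
      proof (cases "\<tau> i < p (Suc j)")
        case True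
        then have "\<tau> i \<le> p j" using less_cell_iff[OF c j, of i "p (Suc j)"] less_iff[of j "Suc j"] i j by simp
        moreover have "\<xi> i \<in> borel_measurable (F (\<tau> i))" using int i by (simp add: simple_integrand_def)
        ultimately have "\<xi> i \<in> borel_measurable (F (p j))" by (rule measurable_F_mono)
        then show ?thesis by simp
      qed (simp add: indicator_def)
    qed
    have "\<forall>i. \<exists>C. i < n \<longrightarrow> (\<forall>\<omega>\<in>space M. \<bar>\<xi> i \<omega>\<bar> \<le> C)" using int by (auto simp: simple_integrand_def)
    then obtain C where C: "\<bar>\<xi> i \<omega>\<bar> \<le> C i" if "i < n" "\<omega> \<in> space M" for i \<omega> by metis
    have "\<bar>simple_process n \<tau> \<xi> (p (Suc j)) \<omega>\<bar> \<le> (\<Sum>i<n. C i)" if "\<omega> \<in> space M" for \<omega>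
      unfolding simple_process_def
    proof (rule order_trans[OF sum_abs sum_mono])
      fix i assume "i \<in> {..<n}"
      then have "\<bar>\<xi> i \<omega>\<bar> \<le> C i" using C that by simp
      then show "\<bar>\<xi> i \<omega> * indicator {\<tau> i<..\<tau> (Suc i)} (p (Suc j))\<bar> \<le> C i"
        by (auto simp: indicator_def)
    qed
    then show "\<exists>C. \<forall>\<omega>\<in>space M. \<bar>simple_process n \<tau> \<xi> (p (Suc j)) \<omega>\<bar> \<le> C" by blast
  qed
  define \<eta> where "\<eta> j \<omega> = simple_process n \<tau> \<xi> (p (Suc j)) \<omega> - simple_process n' \<tau>' \<xi>' (p (Suc j)) \<omega>" for j \<omega>
  have \<eta>_meas: "\<eta> j \<in> borel_measurable (F (p j))" if "j < m" for j
    unfolding \<eta>_def using meas[OF that \<phi> contains] meas[OF that \<psi> contains'] by simp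
  have \<eta>_bdd: "\<exists>C. \<forall>\<omega>\<in>space M. \<bar>\<eta> j \<omega>\<bar> \<le> C" if j: "j < m" for j
  proof -
    obtain C where C: "\<forall>\<omega>\<in>space M. \<bar>simple_process n \<tau> \<xi> (p (Suc j)) \<omega>\<bar> \<le> C"
      using bdd[OF j \<phi> contains] by blast
    obtain C' where C': "\<forall>\<omega>\<in>space M. \<bar>simple_process n' \<tau>' \<xi>' (p (Suc j)) \<omega>\<bar> \<le> C'"
      using bdd[OF j \<psi> contains'] by blast
    have "\<forall>\<omega>\<in>space M. \<bar>\<eta> j \<omega>\<bar> \<le> C + C'"
      unfolding \<eta>_def using C C' by (meson abs_triangle_ineq4 add_mono order_trans)
    then show ?thesis by blast
  qed
  have \<tau>: "0 \<le> \<tau> 0" "\<And>i. i < n \<Longrightarrow> \<tau> i \<le> \<tau> (Suc i)" "0 \<le> \<tau>' 0" "\<And>i. i < n' \<Longrightarrow> \<tau>' i \<le> \<tau>' (Suc i)"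
    using \<phi> \<psi> by (auto simp: simple_integrand_def)
  have eq: "(LBINT s:{0..t}. (simple_process n \<tau> \<xi> s \<omega> - simple_process n' \<tau>' \<xi>' s \<omega>)\<^sup>2) =
      (\<Sum>j<m. (\<eta> j \<omega>)\<^sup>2 * (p (Suc j) - p j))" for \<omega>
  proof -
    have cell: "simple_process n \<tau> \<xi> s \<omega> = simple_process n \<tau> \<xi> (p (Suc j)) \<omega>"
        "simple_process n' \<tau>' \<xi>' s \<omega> = simple_process n' \<tau>' \<xi>' (p (Suc j)) \<omega>"
      if "j < m" "p j < s" "s \<le> p (Suc j)" for j s
      by (rule simple_process_cell[OF contains that], assumption)
         (rule simple_process_cell[OF contains' that], assumption)
    show ?thesis
      unfolding \<eta>_def
    proof (rule step_function_integral)
      show "(simple_process n \<tau> \<xi> s \<omega> - simple_process n' \<tau>' \<xi>' s \<omega>)\<^sup>2 =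
        (simple_process n \<tau> \<xi> (p (Suc j)) \<omega> - simple_process n' \<tau>' \<xi>' (p (Suc j)) \<omega>)\<^sup>2"
        if "j < m" "p j < s" "s \<le> p (Suc j)" for j s
        by (simp only: cell[OF that])
    qed (simp add: simple_process_zero \<tau>)
  qed
  have int: "simple_ito_integral B n \<tau> \<xi> t \<omega> - simple_ito_integral B n' \<tau>' \<xi>' t \<omega> =
      (\<Sum>j<m. \<eta> j \<omega> * (B (p (Suc j)) \<omega> - B (p j) \<omega>))" for \<omega>
    using simple_ito_integral_eq[of n \<tau> B \<xi> \<omega>, OF contains \<tau>(2)]
      simple_ito_integral_eq[of n' \<tau>' B \<xi>' \<omega>, OF contains' \<tau>(4)]
    by (simp add: \<eta>_def left_diff_distrib sum_subtractf)
  have inc: "p j \<le> p (Suc j)" if "j < m" for j using le_iff that by simp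
  show "prob ?L \<le> prob ?R + \<delta> / \<epsilon>\<^sup>2"
    unfolding eq int using elementary_integral_tail[of p m \<eta>, OF _ inc \<eta>_meas \<eta>_bdd pos] first by simp
  show ?meas
    unfolding eq
  proof (rule borel_measurable_sum)
    fix j assume "j \<in> {..<m}"
    then have "\<eta> j \<in> borel_measurable M" using measurable_F_imp[OF \<eta>_meas] by simp
    then show "(\<lambda>\<omega>. (\<eta> j \<omega>)\<^sup>2 * (p (Suc j) - p j)) \<in> borel_measurable M" by simp
  qed
qed

end

section \<open>Uniqueness of the Ito integral\<close>

lemma simple_process_measurable: "(\<lambda>s. simple_process n \<tau> \<xi> s \<omega>) \<in> borel_measurable borel"
  unfolding simple_process_def by measurable

lemma simple_process_bounded: "\<bar>simple_process n \<tau> \<xi> s \<omega>\<bar> \<le> (\<Sum>i<n. \<bar>\<xi> i \<omega>\<bar>)"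
  unfolding simple_process_def
  by (rule order_trans[OF sum_abs sum_mono]) (auto simp: indicator_def)

text \<open>On a fixed path a simple process is bounded by some \<open>K\<close>, and
  \<open>2 * K\<^sup>2 + 2 * (h s)\<^sup>2\<close> dominates the squared difference.\<close>

lemma set_integrable_simple_process_diff_square:
  assumes h: "set_borel_measurable lborel {0..t} h" "set_integrable lborel {0..t} (\<lambda>s. (h s)\<^sup>2)"
  shows "set_integrable lborel {0..t} (\<lambda>s. (simple_process n \<tau> \<xi> s \<omega> - h s)\<^sup>2)"
proof -
  define K where "K = (\<Sum>i<n. \<bar>\<xi> i \<omega>\<bar>)"
  have "set_integrable lborel {0..t} (\<lambda>s. 2 * K\<^sup>2 + 2 * (h s)\<^sup>2)"
    by (intro set_integral_add(1) set_integrable_mult_right h(2) borel_integrable_atLeastAtMost'[OF continuous_on_const])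
  then show ?thesis
  proof (rule set_integrable_bound)
    note [measurable] = simple_process_measurable[of n \<tau> \<xi> \<omega>]
    have [measurable]: "(\<lambda>s. indicator {0..t} s * h s) \<in> borel_measurable borel"
      using h(1) by (simp add: set_borel_measurable_def)
    have "(\<lambda>s. (indicator {0..t} s * simple_process n \<tau> \<xi> s \<omega> - indicator {0..t} s * h s)\<^sup>2) \<in> borel_measurable borel"
      by measurable
    also have "(\<lambda>s. (indicator {0..t} s * simple_process n \<tau> \<xi> s \<omega> - indicator {0..t} s * h s)\<^sup>2) =
        (\<lambda>s. indicator {0..t} s * (simple_process n \<tau> \<xi> s \<omega> - h s)\<^sup>2)"
      by (auto simp: indicator_def)
    finally show "set_borel_measurable lborel {0..t} (\<lambda>s. (simple_process n \<tau> \<xi> s \<omega> - h s)\<^sup>2)"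
      by (simp add: set_borel_measurable_def)
    have "(x - y)\<^sup>2 \<le> 2 * K\<^sup>2 + 2 * y\<^sup>2" if "\<bar>x\<bar> \<le> K" for x y :: real
    proof -
      have "x\<^sup>2 \<le> K\<^sup>2" using that by (metis abs_ge_zero power2_abs power_mono)
      moreover have "0 \<le> (x + y)\<^sup>2" by simp
      ultimately show ?thesis by (simp add: power2_eq_square algebra_simps)
    qed
    then show "AE s in lborel. s \<in> {0..t} \<longrightarrow> norm ((simple_process n \<tau> \<xi> s \<omega> - h s)\<^sup>2) \<le> norm (2 * K\<^sup>2 + 2 * (h s)\<^sup>2)"
      using simple_process_bounded[of n \<tau> \<xi> _ \<omega>] by (intro AE_I2) (auto simp: K_def)
  qed
qed

lemma tendsto_in_probabilityD:
  "tendsto_in_probability M X Y \<Longrightarrow> 0 < \<epsilon> \<Longrightarrow>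
    (\<lambda>k. measure M {\<omega> \<in> space M. \<bar>X k \<omega> - Y \<omega>\<bar> > \<epsilon>}) \<longlonglongrightarrow> 0"
  by (simp add: tendsto_in_probability_def)

lemma closure_positive_rationals: "closure (\<rat> \<inter> {0<..}) = {0::real..}"
proof
  show "closure (\<rat> \<inter> {0<..}) \<subseteq> {0::real..}" by (rule closure_minimal) auto
  have "{0::real<..} \<subseteq> closure (\<rat> \<inter> {0<..})"
    using open_Int_closure_subset[of "{0::real<..}" \<rat>] by (simp add: Rats_closure_real Int_commute)
  then have "closure {0::real<..} \<subseteq> closure (\<rat> \<inter> {0<..})"
    by (rule closure_minimal) simp
  then show "{0::real..} \<subseteq> closure (\<rat> \<inter> {0<..})" by simp
qed

text \<open>The exceptional sets for countably many rational times form one null set; continuity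
  carries equality to the closure of these times, which includes 0.\<close>

lemma indistinguishableI:
  assumes X: "continuous_paths M X" and Y: "continuous_paths M Y"
    and eq: "\<And>t. 0 \<le> t \<Longrightarrow> AE \<omega> in M. X t \<omega> = Y t \<omega>"
  shows "indistinguishable M X Y"
proof -
  have "AE \<omega> in M. \<forall>t\<in>\<rat> \<inter> {0<..}. X t \<omega> = Y t \<omega>"
  proof (subst AE_ball_countable)
    show "countable (\<rat> \<inter> {0<..} :: real set)" using countable_rat by blast
    show "\<forall>t\<in>\<rat> \<inter> {0<..}. AE \<omega> in M. X t \<omega> = Y t \<omega>" using eq by simp
  qed
  then show ?thesis
    using X Y unfolding indistinguishable_def continuous_paths_def
  proof eventually_elim
    case (elim \<omega>)
    have "continuous_on (closure (\<rat> \<inter> {0<..})) (\<lambda>t. X t \<omega> - Y t \<omega>)"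
      using elim unfolding closure_positive_rationals by (intro continuous_on_diff)
    from continuous_constant_on_closure[OF this, of 0] show ?case
      using elim unfolding closure_positive_rationals by auto
  qed
qed

context brownian_motion begin

lemma progressively_measurable_section:
  assumes H: "progressively_measurable F H" and t: "0 \<le> t" and \<omega>: "\<omega> \<in> space M"
  shows "set_borel_measurable lborel {0..t} (\<lambda>s. H s \<omega>)"
proof -
  have "(\<lambda>(s, \<omega>). H s \<omega>) \<in> borel_measurable (restrict_space borel {0..t} \<Otimes>\<^sub>M F t)"
    using H t by (simp add: progressively_measurable_def)
  from measurable_Pair1[OF this, of \<omega>] \<omega>
  have "(\<lambda>s. H s \<omega>) \<in> borel_measurable (restrict_space borel {0..t})" by simp
  then show ?thesis
    by (subst (asm) borel_measurable_restrict_space_iff) (auto simp: set_borel_measurable_def)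
qed

text \<open>\<open>I t\<close> and \<open>J t\<close> are compared through the two approximating
  integrals \<open>P k\<close> and \<open>Q k\<close>. These are close in probability because their
  integrands are both close to \<open>H\<close> in \<open>L\<^sup>2([0,t])\<close>.\<close>

lemma ito_integral_unique_at:
  assumes I: "is_ito_integral M F B H I" and J: "is_ito_integral M F B H J" and t: "0 \<le> t"
  shows "AE \<omega> in M. I t \<omega> = J t \<omega>"
proof -
  obtain n \<tau> \<xi> where simp: "\<And>k::nat. simple_integrand F (n k) (\<tau> k) (\<xi> k)"
    and L2: "tendsto_in_probability M
        (\<lambda>k \<omega>. LBINT s:{0..t}. (simple_process (n k) (\<tau> k) (\<xi> k) s \<omega> - H s \<omega>)\<^sup>2) (\<lambda>\<omega>. 0)"
    and lim: "tendsto_in_probability M (\<lambda>k. simple_ito_integral B (n k) (\<tau> k) (\<xi> k) t) (I t)"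
    using I t unfolding is_ito_integral_def by blast
  obtain n' \<tau>' \<xi>' where simp': "\<And>k::nat. simple_integrand F (n' k) (\<tau>' k) (\<xi>' k)"
    and L2': "tendsto_in_probability M
        (\<lambda>k \<omega>. LBINT s:{0..t}. (simple_process (n' k) (\<tau>' k) (\<xi>' k) s \<omega> - H s \<omega>)\<^sup>2) (\<lambda>\<omega>. 0)"
    and lim': "tendsto_in_probability M (\<lambda>k. simple_ito_integral B (n' k) (\<tau>' k) (\<xi>' k) t) (J t)"
    using J t unfolding is_ito_integral_def by blast
  define \<phi> where "\<phi> k = simple_process (n k) (\<tau> k) (\<xi> k)" for k
  define \<psi> where "\<psi> k = simple_process (n' k) (\<tau>' k) (\<xi>' k)" for k
  define C where "C k \<omega> = (LBINT s:{0..t}. (\<phi> k s \<omega> - H s \<omega>)\<^sup>2)" for k \<omega>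
  define C' where "C' k \<omega> = (LBINT s:{0..t}. (\<psi> k s \<omega> - H s \<omega>)\<^sup>2)" for k \<omega>
  define D where "D k \<omega> = (LBINT s:{0..t}. (\<phi> k s \<omega> - \<psi> k s \<omega>)\<^sup>2)" for k \<omega>
  define P where "P k = simple_ito_integral B (n k) (\<tau> k) (\<xi> k) t" for k
  define Q where "Q k = simple_ito_integral B (n' k) (\<tau>' k) (\<xi>' k) t" for k
  have [measurable]: "C k \<in> borel_measurable M" "C' k \<in> borel_measurable M" "P k \<in> borel_measurable M"
      "Q k \<in> borel_measurable M" "I t \<in> borel_measurable M" "J t \<in> borel_measurable M" for k
    using L2 L2' lim lim' unfolding tendsto_in_probability_def C_def C'_def P_def Q_def \<phi>_def \<psi>_def by auto
  have [measurable]: "D k \<in> borel_measurable M" for k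
    unfolding D_def \<phi>_def \<psi>_def
    by (rule simple_ito_integral_diff_tail(2)[OF simp simp' t, of 1 0]) auto
  have H: "progressively_measurable F H" "AE \<omega> in M. set_integrable lborel {0..t} (\<lambda>s. (H s \<omega>)\<^sup>2)"
    using I t unfolding is_ito_integral_def ito_integrable_def by auto
  have D_le: "AE \<omega> in M. D k \<omega> \<le> 2 * C k \<omega> + 2 * C' k \<omega>" for k
    using H(2) AE_space
  proof eventually_elim
    case (elim \<omega>)
    note int = set_integrable_simple_process_diff_square
    note sec = progressively_measurable_section[OF H(1) t elim(2)]
    have iC: "set_integrable lborel {0..t} (\<lambda>s. (\<phi> k s \<omega> - H s \<omega>)\<^sup>2)"
      and iC': "set_integrable lborel {0..t} (\<lambda>s. (\<psi> k s \<omega> - H s \<omega>)\<^sup>2)"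
      unfolding \<phi>_def \<psi>_def by (rule int[OF sec elim(1)])+
    \<comment> \<open>Comparison with the zero function yields square integrability of
      \<open>\<psi> k\<close>, which may then take the place of \<open>h\<close> in the same
      lemma.\<close>
    have "set_integrable lborel {0..t} (\<lambda>s. (\<psi> k s \<omega> - 0)\<^sup>2)"
      unfolding \<psi>_def by (rule int) (auto simp: set_integrable_def set_borel_measurable_def)
    moreover have "set_borel_measurable lborel {0..t} (\<lambda>s. \<psi> k s \<omega>)"
      unfolding set_borel_measurable_def \<psi>_def
      by (intro borel_measurable_scaleR borel_measurable_indicator)
         (simp_all add: simple_process_measurable)
    ultimately have iD: "set_integrable lborel {0..t} (\<lambda>s. (\<phi> k s \<omega> - \<psi> k s \<omega>)\<^sup>2)"
      unfolding \<phi>_def by (intro int) auto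
    have "D k \<omega> \<le> (LBINT s:{0..t}. 2 * (\<phi> k s \<omega> - H s \<omega>)\<^sup>2 + 2 * (\<psi> k s \<omega> - H s \<omega>)\<^sup>2)"
      unfolding D_def
    proof (rule set_integral_mono[OF iD])
      show "set_integrable lborel {0..t} (\<lambda>s. 2 * (\<phi> k s \<omega> - H s \<omega>)\<^sup>2 + 2 * (\<psi> k s \<omega> - H s \<omega>)\<^sup>2)"
        using iC iC' by (intro set_integral_add set_integrable_mult_right) auto
      have "(x - y)\<^sup>2 \<le> 2 * (x - z)\<^sup>2 + 2 * (y - z)\<^sup>2" for x y z :: real
        using zero_le_power2[of "x + y - 2 * z"] by (simp add: power2_eq_square algebra_simps)
      then show "(\<phi> k s \<omega> - \<psi> k s \<omega>)\<^sup>2 \<le> 2 * (\<phi> k s \<omega> - H s \<omega>)\<^sup>2 + 2 * (\<psi> k s \<omega> - H s \<omega>)\<^sup>2" for s .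
    qed
    also have "\<dots> = 2 * C k \<omega> + 2 * C' k \<omega>"
      unfolding C_def C'_def using iC iC' by (subst set_integral_add) auto
    finally show ?case .
  qed
  \<comment> \<open>If \<open>C k\<close> and \<open>C' k\<close> are both at most
    \<open>\<delta> / 4\<close>, then \<open>D_le\<close> gives
    \<open>D k \<le> \<delta>\<close>.\<close>
  have D_tail: "prob {\<omega> \<in> space M. D k \<omega> > \<delta>} \<le>
      prob {\<omega> \<in> space M. \<bar>C k \<omega> - 0\<bar> > \<delta> / 4} + prob {\<omega> \<in> space M. \<bar>C' k \<omega> - 0\<bar> > \<delta> / 4}" for k \<delta>
  proof -
    have "prob {\<omega> \<in> space M. D k \<omega> > \<delta>} \<le>
        prob ({\<omega> \<in> space M. \<bar>C k \<omega> - 0\<bar> > \<delta> / 4} \<union> {\<omega> \<in> space M. \<bar>C' k \<omega> - 0\<bar> > \<delta> / 4})"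
      using D_le[of k] by (intro finite_measure_mono_AE) (auto elim!: eventually_mono)
    also have "\<dots> \<le> prob {\<omega> \<in> space M. \<bar>C k \<omega> - 0\<bar> > \<delta> / 4} + prob {\<omega> \<in> space M. \<bar>C' k \<omega> - 0\<bar> > \<delta> / 4}"
      by (intro measure_Un_le) measurable
    finally show ?thesis .
  qed
  \<comment> \<open>The factor 3 counts the distances from \<open>I t\<close> to \<open>P k\<close>,
    to \<open>Q k\<close>, to \<open>J t\<close>. Letting \<open>k\<close> tend to infinity with
    \<epsilon> and \<delta> fixed leaves only the Chebyshev term.\<close>
  have bound: "prob {\<omega> \<in> space M. \<bar>I t \<omega> - J t \<omega>\<bar> > 3 * \<epsilon>} \<le> \<delta> / \<epsilon>\<^sup>2" if pos: "\<epsilon> > 0" "\<delta> > 0" for \<epsilon> \<delta>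
  proof -
    define a where "a k = prob {\<omega> \<in> space M. \<bar>P k \<omega> - I t \<omega>\<bar> > \<epsilon>}" for k
    define a' where "a' k = prob {\<omega> \<in> space M. \<bar>Q k \<omega> - J t \<omega>\<bar> > \<epsilon>}" for k
    define c where "c k = prob {\<omega> \<in> space M. \<bar>C k \<omega> - 0\<bar> > \<delta> / 4}" for k
    define c' where "c' k = prob {\<omega> \<in> space M. \<bar>C' k \<omega> - 0\<bar> > \<delta> / 4}" for k
    have lims: "a \<longlonglongrightarrow> 0" "a' \<longlonglongrightarrow> 0" "c \<longlonglongrightarrow> 0" "c' \<longlonglongrightarrow> 0"
      unfolding a_def a'_def c_def c'_def P_def Q_def C_def C'_def \<phi>_def \<psi>_def
      by (rule tendsto_in_probabilityD[OF lim] tendsto_in_probabilityD[OF lim']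
          tendsto_in_probabilityD[OF L2] tendsto_in_probabilityD[OF L2'], use pos in simp)+
    have "prob {\<omega> \<in> space M. \<bar>I t \<omega> - J t \<omega>\<bar> > 3 * \<epsilon>} \<le> a k + a' k + (c k + c' k + \<delta> / \<epsilon>\<^sup>2)" for k
    proof -
      let ?A = "{\<omega> \<in> space M. \<bar>P k \<omega> - I t \<omega>\<bar> > \<epsilon>}" and ?A' = "{\<omega> \<in> space M. \<bar>Q k \<omega> - J t \<omega>\<bar> > \<epsilon>}"
        and ?D = "{\<omega> \<in> space M. \<bar>P k \<omega> - Q k \<omega>\<bar> > \<epsilon>}"
      have "prob {\<omega> \<in> space M. \<bar>I t \<omega> - J t \<omega>\<bar> > 3 * \<epsilon>} \<le> prob (?A \<union> ?A' \<union> ?D)"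
        by (intro finite_measure_mono) auto
      also have "\<dots> \<le> prob (?A \<union> ?A') + prob ?D" by (intro measure_Un_le) measurable
      also have "prob (?A \<union> ?A') \<le> prob ?A + prob ?A'" by (intro measure_Un_le) measurable
      also have "prob ?D \<le> prob {\<omega> \<in> space M. D k \<omega> > \<delta>} + \<delta> / \<epsilon>\<^sup>2"
        unfolding P_def Q_def D_def \<phi>_def \<psi>_def
        using pos by (intro simple_ito_integral_diff_tail(1)[OF simp simp' t]) auto
      also have "prob {\<omega> \<in> space M. D k \<omega> > \<delta>} \<le> c k + c' k"
        unfolding c_def c'_def by (rule D_tail)
      finally show ?thesis unfolding a_def a'_def by simp
    qed
    moreover have "(\<lambda>k. a k + a' k + (c k + c' k + \<delta> / \<epsilon>\<^sup>2)) \<longlonglongrightarrow> 0 + 0 + (0 + 0 + \<delta> / \<epsilon>\<^sup>2)"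
      by (intro tendsto_add lims tendsto_const)
    ultimately show ?thesis by (intro LIMSEQ_le_const) auto
  qed
  have "AE \<omega> in M. \<bar>I t \<omega> - J t \<omega>\<bar> \<le> 3 * inverse (real (Suc i))" for i
  proof -
    let ?e = "inverse (real (Suc i))"
    have "prob {\<omega> \<in> space M. \<bar>I t \<omega> - J t \<omega>\<bar> > 3 * ?e} \<le> 0"
    proof (rule field_le_epsilon)
      fix d :: real assume "d > 0"
      \<comment> \<open>Taking \<open>d * ?e\<^sup>2\<close> for \<delta> turns the remaining
        Chebyshev term into \<open>d\<close>, which is arbitrary.\<close>
      then show "prob {\<omega> \<in> space M. \<bar>I t \<omega> - J t \<omega>\<bar> > 3 * ?e} \<le> 0 + d"
        using bound[of ?e "d * ?e\<^sup>2"] by simp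
    qed
    then have "prob {\<omega> \<in> space M. \<bar>I t \<omega> - J t \<omega>\<bar> > 3 * ?e} = 0" by (simp add: measure_le_0_iff)
    then have "AE \<omega> in M. \<omega> \<notin> {\<omega> \<in> space M. \<bar>I t \<omega> - J t \<omega>\<bar> > 3 * ?e}"
      by (subst (asm) prob_eq_0) auto
    with AE_space show ?thesis by eventually_elim auto
  qed
  then have "AE \<omega> in M. \<forall>i. \<bar>I t \<omega> - J t \<omega>\<bar> \<le> 3 * inverse (real (Suc i))"
    by (subst AE_all_countable) blast
  then show ?thesis
  proof eventually_elim
    case (elim \<omega>)
    have "(\<lambda>i. 3 * inverse (real (Suc i))) \<longlonglongrightarrow> 3 * 0"
      by (intro tendsto_mult_left LIMSEQ_inverse_real_of_nat)
    then have "\<bar>I t \<omega> - J t \<omega>\<bar> \<le> 3 * 0"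
      by (rule LIMSEQ_le_const) (use elim in blast)
    then show ?case by simp
  qed
qed

lemma ito_integral_unique:
  assumes I: "is_ito_integral M F B H I" and J: "is_ito_integral M F B H J"
  shows "indistinguishable M I J"
  using ito_integral_unique_at[OF I J] I J
  by (intro indistinguishableI) (auto simp: is_ito_integral_def)

end

section \<open>Ito integrals of deterministic integrands\<close>

text \<open>The interval reaches to \<open>t + 1\<close>, so that near t it looks like the whole
  half-line; differentiating within \<open>{0..}\<close> covers the one-sided derivative at
  0.\<close>

lemma integral_from_zero_has_real_derivative:
  fixes g :: "real \<Rightarrow> real"
  assumes g: "continuous_on {0..} g" and t: "0 \<le> t"
  shows "((\<lambda>u. integral {0..u} g) has_real_derivative g t) (at t within {0..})"
proof -
  have "((\<lambda>u. integral {0..u} g) has_vector_derivative g t) (at t within {0..t + 1})"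
    using g t by (intro integral_has_vector_derivative) (auto intro: continuous_on_subset)
  moreover have "at t within {0..t + 1} = at t within {0..}"
    by (rule at_within_nhd[of t "{..<t + 1}"]) auto
  ultimately show ?thesis by (simp add: has_real_derivative_iff_has_vector_derivative)
qed

lemma continuous_on_integral_from_zero:
  fixes g :: "real \<Rightarrow> real"
  assumes "continuous_on {0..} g"
  shows "continuous_on {0..} (\<lambda>u. integral {0..u} g)"
  unfolding continuous_on_eq_continuous_within
  using integral_from_zero_has_real_derivative[OF assms] DERIV_continuous by fastforce

text \<open>With \<open>Suc k * Suc k\<close> cells of this width the grid covers
  \<open>{0..Suc k}\<close>. It refines and exhausts the half-line at once, as required by an
  integral defined through one approximating sequence for all time horizons.\<close>

definition grid_mesh :: "nat \<Rightarrow> real" where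
  "grid_mesh k = inverse (real (Suc k))"

lemma grid_mesh_pos: "0 < grid_mesh k"
  by (simp add: grid_mesh_def)

lemma grid_end: "real (Suc k * Suc k) * grid_mesh k = real (Suc k)"
  by (simp only: grid_mesh_def of_nat_mult) (simp add: field_simps)

lemma grid_fine_eventually:
  assumes "0 < d"
  shows "eventually (\<lambda>k. grid_mesh k < d \<and> t \<le> real (Suc k)) sequentially"
proof (rule eventually_conj)
  show "eventually (\<lambda>k. grid_mesh k < d) sequentially"
    unfolding grid_mesh_def using order_tendstoD(2)[OF LIMSEQ_inverse_real_of_nat assms] .
  show "eventually (\<lambda>k. t \<le> real (Suc k)) sequentially"
    using eventually_ge_at_top[of "nat \<lceil>t\<rceil>"] by eventually_elim linarith
qed

section \<open>Pathwise Riemann sums of a continuously differentiable integrand\<close>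

context
  fixes f f' :: "real \<Rightarrow> real"
  assumes deriv: "\<And>s. 0 \<le> s \<Longrightarrow> (f has_real_derivative f' s) (at s)"
    and cont': "continuous_on {0..} f'"
begin

lemma integrand_continuous: "continuous_on {0..} f"
  by (rule DERIV_continuous_on[where D=f'], rule has_field_derivative_at_within, rule deriv) simp

text \<open>The first term on the right is a summand of the Riemann sum; the second is its error,
  bounded by the size of \<open>f'\<close>, the oscillation of \<open>w\<close> and the cell length.
  No bounded variation of \<open>w\<close> enters.\<close>

lemma integration_by_parts_increment:
  assumes w: "continuous_on {0..} w" and uv: "0 \<le> u" "u \<le> v"
  shows "(f v * w v - integral {0..v} (\<lambda>s. f' s * w s)) - (f u * w u - integral {0..u} (\<lambda>s. f' s * w s))
    = f u * (w v - w u) + integral {u..v} (\<lambda>s. f' s * (w v - w s))"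
proof -
  have c: "continuous_on {0..} (\<lambda>s. f' s * w s)" by (intro continuous_on_mult cont' w)
  have int: "(\<lambda>s. f' s * w s) integrable_on {a..b}" if "0 \<le> a" for a b
    by (rule integrable_continuous_real, rule continuous_on_subset[OF c]) (use that in auto)
  have int': "f' integrable_on {u..v}"
    by (rule integrable_continuous_real, rule continuous_on_subset[OF cont']) (use uv in auto)
  have "(f' has_integral (f v - f u)) {u..v}"
    using uv deriv by (intro fundamental_theorem_of_calculus)
      (auto simp: has_real_derivative_iff_has_vector_derivative[symmetric] intro: has_field_derivative_at_within)
  then have f': "integral {u..v} f' = f v - f u" by (rule integral_unique)
  have "integral {u..v} (\<lambda>s. f' s * (w v - w s)) = integral {u..v} (\<lambda>s. w v * f' s - f' s * w s)"
    by (simp add: algebra_simps)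
  also have "\<dots> = w v * (f v - f u) - integral {u..v} (\<lambda>s. f' s * w s)"
    using int[OF uv(1)] integrable_on_mult_right[OF int', of "w v"]
    by (subst Henstock_Kurzweil_Integration.integral_diff) (auto simp: f')
  also have "integral {u..v} (\<lambda>s. f' s * w s) = integral {0..v} (\<lambda>s. f' s * w s) - integral {0..u} (\<lambda>s. f' s * w s)"
    using Henstock_Kurzweil_Integration.integral_combine[OF uv int[of 0 v]] by simp
  finally show ?thesis by (simp add: algebra_simps)
qed

lemma riemann_stieltjes_sums_tendsto:
  assumes w: "continuous_on {0..} w" "w 0 = 0" and t: "0 \<le> t"
  shows "(\<lambda>k. \<Sum>i<Suc k * Suc k. f (real i * grid_mesh k) *
      (w (min (real (Suc i) * grid_mesh k) t) - w (min (real i * grid_mesh k) t)))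
    \<longlonglongrightarrow> f t * w t - integral {0..t} (\<lambda>s. f' s * w s)"
proof (rule LIMSEQ_I)
  fix e :: real assume e: "0 < e"
  define G where "G v = f v * w v - integral {0..v} (\<lambda>s. f' s * w s)" for v
  have "compact (f' ` {0..t})"
    by (rule compact_continuous_image[OF continuous_on_subset[OF cont']]) auto
  then obtain K where K: "0 < K" "\<And>s. s \<in> {0..t} \<Longrightarrow> \<bar>f' s\<bar> \<le> K"
    using compact_imp_bounded[THEN bounded_pos[THEN iffD1]] by force
  \<comment> \<open>The total error is at most \<open>K * e' * t\<close>; this choice makes it less
    than \<open>e\<close>, and \<open>t + 1\<close> avoids division by zero at time 0.\<close>
  define e' where "e' = e / (2 * K * (t + 1))"
  have e': "0 < e'" using e K t by (simp add: e'_def)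
  have "uniformly_continuous_on {0..t} w"
    by (rule compact_uniformly_continuous[OF continuous_on_subset[OF w(1)]]) auto
  then obtain d where d: "0 < d" "\<And>x y. x \<in> {0..t} \<Longrightarrow> y \<in> {0..t} \<Longrightarrow> dist y x < d \<Longrightarrow> dist (w y) (w x) < e'"
    unfolding uniformly_continuous_on_def using e' by metis
  have step: "\<bar>G v - G u - f u * (w v - w u)\<bar> \<le> K * e' * (v - u)"
    if uv: "0 \<le> u" "u \<le> v" "v \<le> t" "v - u < d" for u v
  proof -
    have "\<bar>integral {u..v} (\<lambda>s. f' s * (w v - w s))\<bar> \<le> K * e' * (v - u)"
    proof (rule integral_bound[where 'a=real, unfolded real_norm_def])
      show "u \<le> v" by fact
      show "continuous_on {u..v} (\<lambda>s. f' s * (w v - w s))"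
        using uv by (intro continuous_intros continuous_on_subset[OF cont'] continuous_on_subset[OF w(1)]) auto
      fix s assume s: "s \<in> {u..v}"
      then have "\<bar>f' s\<bar> \<le> K" "\<bar>w v - w s\<bar> \<le> e'"
        using K(2)[of s] d(2)[of s v] uv by (auto simp: dist_real_def)
      then show "\<bar>f' s * (w v - w s)\<bar> \<le> K * e'"
        unfolding abs_mult using K by (intro mult_mono) auto
    qed
    then show ?thesis
      using integration_by_parts_increment[OF w(1) uv(1,2)] by (simp add: G_def)
  qed
  have "eventually (\<lambda>k. norm ((\<Sum>i<Suc k * Suc k. f (real i * grid_mesh k) *
      (w (min (real (Suc i) * grid_mesh k) t) - w (min (real i * grid_mesh k) t))) - G t) < e) sequentially"
    using grid_fine_eventually[OF d(1), of t]
  proof eventually_elim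
    case (elim k)
    define u where "u i = min (real i * grid_mesh k) t" for i
    let ?n = "Suc k * Suc k"
    have pos: "0 < grid_mesh k" by (rule grid_mesh_pos)
    have u: "0 \<le> u i" "u i \<le> u (Suc i)" "u (Suc i) \<le> t" "u (Suc i) - u i < d" for i
      using pos t elim by (auto simp: u_def min_def distrib_right)
    have u0: "u 0 = 0" and un: "u ?n = t"
      using t elim by (simp_all only: u_def grid_end) simp_all
    \<comment> \<open>The sums evaluate \<open>f\<close> at uncapped grid points; beyond t both
      capped points equal t and the increment of \<open>w\<close> vanishes.\<close>
    have shift: "f (real i * grid_mesh k) * (w (u (Suc i)) - w (u i)) = f (u i) * (w (u (Suc i)) - w (u i))" for i
    proof (cases "real i * grid_mesh k \<le> t")
      case False
      then have "u i = t" "u (Suc i) = t" using pos by (auto simp: u_def distrib_right)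
      then show ?thesis by simp
    qed (simp add: u_def)
    have "G t = (\<Sum>i<?n. G (u (Suc i)) - G (u i))"
      using sum_lessThan_telescope[of "\<lambda>i. G (u i)" ?n] by (simp only: u0 un) (simp add: G_def w)
    then have "\<bar>(\<Sum>i<?n. f (real i * grid_mesh k) * (w (u (Suc i)) - w (u i))) - G t\<bar> =
        \<bar>\<Sum>i<?n. G (u (Suc i)) - G (u i) - f (u i) * (w (u (Suc i)) - w (u i))\<bar>"
      by (simp only: shift sum_subtractf abs_minus_commute)
    also have "\<dots> \<le> (\<Sum>i<?n. K * e' * (u (Suc i) - u i))"
      by (rule order_trans[OF sum_abs sum_mono]) (use step u in blast)
    also have "\<dots> = K * e' * t"
      by (simp only: sum_distrib_left[symmetric] sum_lessThan_telescope u0 un) simp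
    also have "\<dots> < e"
    proof -
      have "K * e' = e / (2 * (t + 1))" using K t by (simp add: e'_def)
      then have "K * e' * t = e * (t / (2 * (t + 1)))" by simp
      also have "\<dots> < e * 1" using e t by (intro mult_strict_left_mono) auto
      finally show ?thesis by simp
    qed
    finally show ?case by (simp only: u_def real_norm_def)
  qed
  then show "\<exists>k0. \<forall>k\<ge>k0. norm ((\<Sum>i<Suc k * Suc k. f (real i * grid_mesh k) *
      (w (min (real (Suc i) * grid_mesh k) t) - w (min (real i * grid_mesh k) t)))
      - (f t * w t - integral {0..t} (\<lambda>s. f' s * w s))) < e"
    by (simp only: eventually_sequentially G_def)
qed

lemma grid_step_functions_L2_tendsto:
  assumes t: "0 \<le> t"
  shows "(\<lambda>k. LBINT s:{0..t}. (simple_process (Suc k * Suc k) (\<lambda>i. real i * grid_mesh k)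
      (\<lambda>i \<omega>. f (real i * grid_mesh k)) s \<omega> - f s)\<^sup>2) \<longlonglongrightarrow> 0"
proof (rule LIMSEQ_I)
  fix e :: real assume e: "0 < e"
  define \<phi> where "\<phi> k s = simple_process (Suc k * Suc k) (\<lambda>i. real i * grid_mesh k)
      (\<lambda>i \<omega>. f (real i * grid_mesh k)) s \<omega>" for k s
  define e' where "e' = sqrt (e / (2 * (t + 1)))"
  have e': "0 < e'" "e'\<^sup>2 = e / (2 * (t + 1))" using e t by (simp_all add: e'_def)
  have "uniformly_continuous_on {0..t} f"
    by (rule compact_uniformly_continuous[OF continuous_on_subset[OF integrand_continuous]]) auto
  then obtain d where d: "0 < d" "\<And>x y. x \<in> {0..t} \<Longrightarrow> y \<in> {0..t} \<Longrightarrow> dist y x < d \<Longrightarrow> dist (f y) (f x) < e'"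
    unfolding uniformly_continuous_on_def using e' by metis
  have f_cont: "continuous_on {0..t} f" by (rule continuous_on_subset[OF integrand_continuous]) auto
  have "eventually (\<lambda>k. norm ((LBINT s:{0..t}. (\<phi> k s - f s)\<^sup>2) - 0) < e) sequentially"
    using grid_fine_eventually[OF d(1), of t]
  proof eventually_elim
    case (elim k)
    let ?n = "Suc k * Suc k" and ?p = "\<lambda>i. real i * grid_mesh k"
    have pos: "0 < grid_mesh k" by (rule grid_mesh_pos)
    interpret time_grid ?p ?n "real (Suc k)"
      using pos grid_end by unfold_locales (auto simp: strict_mono_on_def)
    have close: "\<bar>\<phi> k s - f s\<bar> \<le> e'" if s: "0 < s" "s \<le> t" for s
    proof -
      \<comment> \<open>This partition of unity distributes \<open>f s\<close> over the cells, so
        the error can be estimated cell by cell.\<close>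
      have one: "(\<Sum>i<?n. indicator {?p i<..?p (Suc i)} s) = (1::real)"
        unfolding sum_indicator_cells using s elim by simp
      have "\<phi> k s - f s = (\<Sum>i<?n. f (?p i) * indicator {?p i<..?p (Suc i)} s)
          - f s * (\<Sum>i<?n. indicator {?p i<..?p (Suc i)} s)"
        unfolding one by (simp add: \<phi>_def simple_process_def)
      also have "\<dots> = (\<Sum>i<?n. (f (?p i) - f s) * indicator {?p i<..?p (Suc i)} s)"
        by (simp only: sum_distrib_left left_diff_distrib sum_subtractf)
      also have "\<bar>\<dots>\<bar> \<le> (\<Sum>i<?n. e' * indicator {?p i<..?p (Suc i)} s)"
      proof (rule order_trans[OF sum_abs sum_mono])
        fix i
        show "\<bar>(f (?p i) - f s) * indicator {?p i<..?p (Suc i)} s\<bar> \<le> e' * indicator {?p i<..?p (Suc i)} s"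
        proof (cases "s \<in> {?p i<..?p (Suc i)}")
          case True
          then have "?p i \<in> {0..t}" "s \<in> {0..t}" "dist (?p i) s < d"
            using s elim pos by (auto simp: dist_real_def distrib_right)
          then have "\<bar>f (?p i) - f s\<bar> \<le> e'" using d(2)[of s "?p i"] by (simp add: dist_real_def)
          then show ?thesis using True by simp
        qed simp
      qed
      also have "\<dots> = e'" by (simp only: sum_distrib_left[symmetric] one mult_1_right)
      finally show ?thesis .
    qed
    have "set_integrable lborel {0..t} (\<lambda>s. (\<phi> k s - f s)\<^sup>2)"
      unfolding \<phi>_def
    proof (rule set_integrable_simple_process_diff_square)
      show "set_borel_measurable lborel {0..t} f"
        using borel_integrable_atLeastAtMost'[OF f_cont]
        by (simp add: set_borel_measurable_def set_integrable_def borel_measurable_integrable)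
      show "set_integrable lborel {0..t} (\<lambda>s. (f s)\<^sup>2)"
        by (intro borel_integrable_atLeastAtMost' continuous_intros f_cont)
    qed
    moreover have "set_integrable lborel {0..t} (\<lambda>s. e'\<^sup>2)"
      by (intro borel_integrable_atLeastAtMost' continuous_intros)
    \<comment> \<open>At time 0 the simple process is 0 whatever \<open>f 0\<close> is, so that
      single point is excluded.\<close>
    moreover have "AE s\<in>{0..t} in lborel. (\<phi> k s - f s)\<^sup>2 \<le> e'\<^sup>2"
      using AE_lborel_singleton[of 0]
    proof eventually_elim
      case (elim s)
      show ?case
        using close[of s] elim e'(1) by (auto simp: abs_le_square_iff[symmetric])
    qed
    ultimately have "(LBINT s:{0..t}. (\<phi> k s - f s)\<^sup>2) \<le> (LBINT s:{0..t}. e'\<^sup>2)"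
      by (rule set_integral_mono_AE)
    also have "\<dots> = t * e'\<^sup>2"
      using t by (simp add: set_lebesgue_integral_def)
    also have "\<dots> < e"
    proof -
      have "t * e'\<^sup>2 = e * (t / (2 * (t + 1)))" using t by (simp add: e'(2) field_simps)
      also have "\<dots> < e * 1" using e t by (intro mult_strict_left_mono) auto
      finally show ?thesis by simp
    qed
    finally have "(LBINT s:{0..t}. (\<phi> k s - f s)\<^sup>2) < e" .
    moreover have "0 \<le> (LBINT s:{0..t}. (\<phi> k s - f s)\<^sup>2)"
      unfolding set_lebesgue_integral_def by (rule Bochner_Integration.integral_nonneg) simp
    ultimately show ?case by simp
  qed
  then show "\<exists>k0. \<forall>k\<ge>k0. norm ((LBINT s:{0..t}. (simple_process (Suc k * Suc k) (\<lambda>i. real i * grid_mesh k)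
      (\<lambda>i \<omega>. f (real i * grid_mesh k)) s \<omega> - f s)\<^sup>2) - 0) < e"
    by (simp only: eventually_sequentially \<phi>_def)
qed

end

context brownian_motion begin

text \<open>The indicators of the deviation events tend to 0 almost surely and are bounded by 1;
  dominated convergence gives their probabilities.\<close>

lemma tendsto_in_probability_AE:
  assumes [measurable]: "\<And>k. X k \<in> borel_measurable M" "Y \<in> borel_measurable M"
    and lim: "AE \<omega> in M. (\<lambda>k. X k \<omega>) \<longlonglongrightarrow> Y \<omega>"
  shows "tendsto_in_probability M X Y"
  unfolding tendsto_in_probability_def
proof (intro conjI allI impI)
  fix \<epsilon> :: real assume \<epsilon>: "0 < \<epsilon>"
  let ?A = "\<lambda>k. {\<omega> \<in> space M. \<bar>X k \<omega> - Y \<omega>\<bar> > \<epsilon>}"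
  have "(\<lambda>k. \<integral>\<omega>. indicator (?A k) \<omega> \<partial>M) \<longlonglongrightarrow> (\<integral>\<omega>. (0::real) \<partial>M)"
  proof (rule integral_dominated_convergence[where w="\<lambda>_. 1"])
    show "AE \<omega> in M. (\<lambda>k. indicator (?A k) \<omega> :: real) \<longlonglongrightarrow> 0"
      using lim
    proof eventually_elim
      case (elim \<omega>)
      from tendstoD[OF this \<epsilon>] have "eventually (\<lambda>k. indicator (?A k) \<omega> = (0::real)) sequentially"
        by eventually_elim (simp add: dist_real_def)
      then show ?case by (rule tendsto_eventually)
    qed
  qed (auto simp: indicator_def)
  then show "(\<lambda>k. prob (?A k)) \<longlonglongrightarrow> 0" by simp
qed (use assms in auto)

lemma ito_integrable_deterministic:
  assumes f: "continuous_on {0..} f"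
  shows "ito_integrable M F (\<lambda>s \<omega>. f s)"
  unfolding ito_integrable_def progressively_measurable_def
proof (intro conjI allI impI AE_I2)
  fix t :: real assume "0 \<le> t"
  have "f \<in> borel_measurable (restrict_space borel {0..t})"
    by (rule borel_measurable_continuous_on_restrict, rule continuous_on_subset[OF f]) auto
  from measurable_compose[OF measurable_fst this]
  show "(\<lambda>(s, \<omega>). f s) \<in> borel_measurable (restrict_space borel {0..t} \<Otimes>\<^sub>M F t)"
    by (simp add: case_prod_beta')
next
  fix t :: real
  show "set_integrable lborel {0..t} (\<lambda>s. (f s)\<^sup>2)"
    by (intro borel_integrable_atLeastAtMost' continuous_intros continuous_on_subset[OF f]) auto
qed

text \<open>The by-parts expression is the limit of the Riemann sums on every path that is
  continuous and starts at 0. Almost sure convergence gives convergence in probability, and the sums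
  are simple Ito integrals.\<close>

lemma deterministic_ito_integral_exists:
  fixes f f' :: "real \<Rightarrow> real"
  assumes deriv: "\<And>s. 0 \<le> s \<Longrightarrow> (f has_real_derivative f' s) (at s)"
    and cont': "continuous_on {0..} f'"
  obtains I where "is_ito_integral M F B (\<lambda>s \<omega>. f s) I"
    and "AE \<omega> in M. \<forall>t\<ge>0. I t \<omega> = f t * B t \<omega> - integral {0..t} (\<lambda>s. f' s * B s \<omega>)"
proof -
  note f_cont = integrand_continuous[OF deriv cont']
  have "AE \<omega> in M. B 0 \<omega> = 0 \<and> continuous_on {0..} (\<lambda>t. B t \<omega>)"
    using B_zero B_continuous by eventually_elim simp
  then obtain N where N: "N \<in> null_sets M"
    and good: "\<And>\<omega>. \<omega> \<in> space M - N \<Longrightarrow> B 0 \<omega> = 0 \<and> continuous_on {0..} (\<lambda>t. B t \<omega>)"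
    by (rule AE_E3) blast
  have AE_N: "AE \<omega> in M. \<omega> \<in> space M - N"
    using AE_not_in[OF N] AE_space by eventually_elim simp
  define I where "I t \<omega> = (if \<omega> \<in> N then 0 else f t * B t \<omega> - integral {0..t} (\<lambda>s. f' s * B s \<omega>))" for t \<omega>
  let ?n = "\<lambda>k. Suc k * Suc k" and ?\<tau> = "\<lambda>k i. real i * grid_mesh k"
    and ?\<xi> = "\<lambda>k i (\<omega>::'a). f (real i * grid_mesh k)"
  define R where "R k t = simple_ito_integral B (?n k) (?\<tau> k) (?\<xi> k) t" for k t
  have mesh: "0 \<le> ?\<tau> k i" for k i using grid_mesh_pos[of k] by simp
  have R_meas: "R k t \<in> borel_measurable (F t)" if t: "0 \<le> t" for k t
    unfolding R_def simple_ito_integral_def[abs_def]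
    by (intro borel_measurable_sum borel_measurable_times borel_measurable_diff borel_measurable_const
        B_measurable_F min.boundedI mesh t min.cobounded2)
  have R_lim: "(\<lambda>k. R k t \<omega>) \<longlonglongrightarrow> I t \<omega>" if "0 \<le> t" "\<omega> \<in> space M - N" for t \<omega>
    using riemann_stieltjes_sums_tendsto[OF deriv cont', of "\<lambda>t. B t \<omega>" t] good[OF that(2)] that
    by (simp add: R_def simple_ito_integral_def I_def)
  have adapted: "I t \<in> borel_measurable (F t)" if t: "0 \<le> t" for t
  proof (rule borel_measurable_LIMSEQ_real)
    have [measurable]: "N \<in> sets (F t)" by (rule null_sets_in_F[OF N])
    have [measurable]: "R k t \<in> borel_measurable (F t)" for k by (rule R_meas[OF t])
    \<comment> \<open>Resetting the sums on \<open>N\<close> makes them converge to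
      \<open>I t\<close> at every point, so measurability with respect to \<open>F t\<close> passes
      to the limit.\<close>
    show "(\<lambda>\<omega>. if \<omega> \<in> N then 0 else R k t \<omega>) \<in> borel_measurable (F t)" for k by measurable
    fix \<omega> assume "\<omega> \<in> space (F t)"
    then show "(\<lambda>k. if \<omega> \<in> N then 0 else R k t \<omega>) \<longlonglongrightarrow> I t \<omega>"
      using R_lim[OF t, of \<omega>] by (cases "\<omega> \<in> N") (simp_all add: I_def)
  qed
  have "is_ito_integral M F B (\<lambda>s \<omega>. f s) I"
    unfolding is_ito_integral_def
  proof (intro conjI exI[of _ ?n] exI[of _ ?\<tau>] exI[of _ ?\<xi>] allI impI)
    show "ito_integrable M F (\<lambda>s \<omega>. f s)" by (rule ito_integrable_deterministic[OF f_cont])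
    show "adapted_process F I" using adapted by (simp add: adapted_process_def)
    show "continuous_paths M I"
      unfolding continuous_paths_def using AE_N
    proof eventually_elim
      case (elim \<omega>)
      have "continuous_on {0..} (\<lambda>t. f t * B t \<omega> - integral {0..t} (\<lambda>s. f' s * B s \<omega>))"
        using good[OF elim] f_cont cont'
        by (intro continuous_on_diff continuous_on_mult continuous_on_integral_from_zero) auto
      then show ?case using elim by (simp add: I_def)
    qed
    show "simple_integrand F (?n k) (?\<tau> k) (?\<xi> k)" for k
      using mesh[of k] grid_mesh_pos[of k] by (auto simp: simple_integrand_def distrib_right)
    show "tendsto_in_probability M (\<lambda>k \<omega>. LBINT s:{0..t}. (simple_process (?n k) (?\<tau> k) (?\<xi> k) s \<omega> - f s)\<^sup>2) (\<lambda>\<omega>. 0)"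
      if "0 \<le> t" for t
    proof (rule tendsto_in_probability_AE)
      \<comment> \<open>The integrand is deterministic; passing to the one-point sample space shows
        that the integral is constant in \<open>\<omega>\<close> and therefore measurable.\<close>
      have *: "simple_process (?n k) (?\<tau> k) (?\<xi> k) s \<omega> = simple_process (?n k) (?\<tau> k) (\<lambda>i \<omega>. f (?\<tau> k i)) s ()" for k s \<omega>
        by (simp add: simple_process_def)
      show "(\<lambda>\<omega>. LBINT s:{0..t}. (simple_process (?n k) (?\<tau> k) (?\<xi> k) s \<omega> - f s)\<^sup>2) \<in> borel_measurable M" for k
        unfolding * by simp
      show "AE \<omega> in M. (\<lambda>k. LBINT s:{0..t}. (simple_process (?n k) (?\<tau> k) (?\<xi> k) s \<omega> - f s)\<^sup>2) \<longlonglongrightarrow> 0"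
        by (intro AE_I2 grid_step_functions_L2_tendsto[OF deriv cont' that])
    qed simp
    show "tendsto_in_probability M (\<lambda>k. simple_ito_integral B (?n k) (?\<tau> k) (?\<xi> k) t) (I t)" if t: "0 \<le> t" for t
      unfolding R_def[symmetric]
    proof (rule tendsto_in_probability_AE)
      show "R k t \<in> borel_measurable M" for k by (rule measurable_F_imp[OF R_meas[OF t]])
      show "I t \<in> borel_measurable M" by (rule measurable_F_imp[OF adapted[OF t]])
      show "AE \<omega> in M. (\<lambda>k. R k t \<omega>) \<longlonglongrightarrow> I t \<omega>"
        using AE_N by eventually_elim (rule R_lim[OF t])
    qed
  qed
  moreover have "AE \<omega> in M. \<forall>t\<ge>0. I t \<omega> = f t * B t \<omega> - integral {0..t} (\<lambda>s. f' s * B s \<omega>)"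
    using AE_N by eventually_elim (simp add: I_def)
  ultimately show thesis by (rule that)
qed

text \<open>Existence makes the chosen process an Ito integral, and uniqueness carries the by-parts
  formula over to it.\<close>

lemma deterministic_ito_integral:
  fixes f f' :: "real \<Rightarrow> real"
  assumes deriv: "\<And>s. 0 \<le> s \<Longrightarrow> (f has_real_derivative f' s) (at s)"
    and cont': "continuous_on {0..} f'"
  shows "is_ito_integral M F B (\<lambda>s \<omega>. f s) (ito_integral M F B (\<lambda>s \<omega>. f s))"
    and "AE \<omega> in M. \<forall>t\<ge>0. ito_integral M F B (\<lambda>s \<omega>. f s) t \<omega> =
      f t * B t \<omega> - integral {0..t} (\<lambda>s. f' s * B s \<omega>)"
proof -
  obtain I where I: "is_ito_integral M F B (\<lambda>s \<omega>. f s) I"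
    "AE \<omega> in M. \<forall>t\<ge>0. I t \<omega> = f t * B t \<omega> - integral {0..t} (\<lambda>s. f' s * B s \<omega>)"
    using deterministic_ito_integral_exists[OF deriv cont'] by blast
  show J: "is_ito_integral M F B (\<lambda>s \<omega>. f s) (ito_integral M F B (\<lambda>s \<omega>. f s))"
    unfolding ito_integral_def by (rule someI[of _ I]) (rule I)
  show "AE \<omega> in M. \<forall>t\<ge>0. ito_integral M F B (\<lambda>s \<omega>. f s) t \<omega> =
      f t * B t \<omega> - integral {0..t} (\<lambda>s. f' s * B s \<omega>)"
    using ito_integral_unique[OF J I(1)] I(2) unfolding indistinguishable_def
    by eventually_elim simp
qed

end

section \<open>Linear integral equations\<close>

text \<open>Multiplying by the integrating factor \<open>f\<close> makes the difference of two solutions constant.\<close>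

lemma linear_integral_equation_unique:
  fixes f h x y z :: "real \<Rightarrow> real"
  assumes f: "\<And>t. 0 \<le> t \<Longrightarrow> (f has_real_derivative h t * f t) (at t)" "\<And>t. 0 \<le> t \<Longrightarrow> f t \<noteq> 0"
    and h: "continuous_on {0..} h" and x: "continuous_on {0..} x" and y: "continuous_on {0..} y"
    and eq_x: "\<And>t. 0 \<le> t \<Longrightarrow> x t = x0 - integral {0..t} (\<lambda>s. h s * x s) + z t"
    and eq_y: "\<And>t. 0 \<le> t \<Longrightarrow> y t = x0 - integral {0..t} (\<lambda>s. h s * y s) + z t"
    and t: "0 \<le> t"
  shows "x t = y t"
proof -
  \<comment> \<open>\<open>x\<close> and \<open>y\<close> are only continuous, but the forcing
    \<open>z\<close> cancels in their difference. Written through the integrals, that difference is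
    differentiable.\<close>
  define D where "D t = integral {0..t} (\<lambda>s. h s * y s) - integral {0..t} (\<lambda>s. h s * x s)" for t
  have D: "x t - y t = D t" if "0 \<le> t" for t using eq_x[OF that] eq_y[OF that] by (simp add: D_def)
  have "((\<lambda>t. f t * D t) has_real_derivative 0) (at s within {0..})" if s: "s \<in> {0..}" for s
  proof -
    have "(D has_real_derivative h s * y s - h s * x s) (at s within {0..})"
      unfolding D_def using s
      by (intro DERIV_diff integral_from_zero_has_real_derivative continuous_on_mult h x y) auto
    from DERIV_mult[OF has_field_derivative_at_within[OF f(1)] this] s
    have "((\<lambda>t. f t * D t) has_real_derivative h s * f s * D s + (h s * y s - h s * x s) * f s) (at s within {0..})"
      by simp
    moreover have "h s * y s - h s * x s = - (h s * D s)" using D[of s] s by (simp add: algebra_simps)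
    ultimately show ?thesis by (simp add: algebra_simps)
  qed
  from has_field_derivative_zero_constant[OF _ this]
  obtain c where "\<And>s. s \<in> {0..} \<Longrightarrow> f s * D s = c" by auto
  from this[of t] this[of 0] have "f t * D t = f 0 * D 0" using t by simp
  then have "D t = 0" using f(2)[OF t] by (simp add: D_def)
  then show ?thesis using D[OF t] by simp
qed

text \<open>\<open>w\<close> need not be differentiable, so \<open>x\<close> is split as
  \<open>y + \<sigma> * w\<close>. The part \<open>y\<close> is differentiable with derivative
  \<open>- (h s * x s)\<close>, and integrating this gives the equation.\<close>

lemma variation_of_constants:
  fixes f h w :: "real \<Rightarrow> real"
  assumes f: "\<And>t. 0 \<le> t \<Longrightarrow> (f has_real_derivative h t * f t) (at t)" "\<And>t. 0 \<le> t \<Longrightarrow> f t \<noteq> 0" "f 0 = 1"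
    and h: "continuous_on {0..} h" and w: "continuous_on {0..} w"
    and x: "\<And>t. 0 \<le> t \<Longrightarrow> x t = (x0 + \<sigma> * (f t * w t - integral {0..t} (\<lambda>s. h s * f s * w s))) / f t"
    and t: "0 \<le> t"
  shows "x t = x0 - integral {0..t} (\<lambda>s. h s * x s) + \<sigma> * w t"
proof -
  have f_cont: "continuous_on {0..} f"
    by (rule DERIV_continuous_on[where D="\<lambda>t. h t * f t"], rule has_field_derivative_at_within, rule f) simp
  define y where "y t = (x0 - \<sigma> * integral {0..t} (\<lambda>s. h s * f s * w s)) / f t" for t
  have xy: "x t = y t + \<sigma> * w t" if "0 \<le> t" for t
    using f(2)[OF that] unfolding x[OF that] y_def by (simp add: field_simps)
  \<comment> \<open>The quotient rule for \<open>y\<close>, with \<open>a\<close>, \<open>b\<close>,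
    \<open>c\<close> for \<open>h s\<close>, \<open>f s\<close>, \<open>w s\<close> and
    \<open>Z\<close> for the numerator of \<open>y s\<close>.\<close>
  have quotient: "((0 - \<sigma> * (a * b * c)) * b - Z * (a * b)) / (b * b) = - (a * (Z / b + \<sigma> * c))"
    if "b \<noteq> 0" for a b c Z :: real
    using that by (simp add: field_simps)
  have y_deriv: "(y has_real_derivative - (h s * x s)) (at s within {0..t})" if s: "0 \<le> s" "s \<le> t" for s
  proof -
    have "((\<lambda>u. integral {0..u} (\<lambda>s. h s * f s * w s)) has_real_derivative h s * f s * w s) (at s within {0..})"
      using s by (intro integral_from_zero_has_real_derivative continuous_on_mult h f_cont w)
    from DERIV_divide[OF DERIV_diff[OF DERIV_const[of x0] DERIV_cmult[OF this, of \<sigma>]]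
        has_field_derivative_at_within[OF f(1)[OF s(1)]] f(2)[OF s(1)]]
    have "(y has_real_derivative
        ((0 - \<sigma> * (h s * f s * w s)) * f s - (x0 - \<sigma> * integral {0..s} (\<lambda>s. h s * f s * w s)) * (h s * f s)) / (f s * f s))
        (at s within {0..})"
      by (simp only: y_def[abs_def])
    also have "((0 - \<sigma> * (h s * f s * w s)) * f s - (x0 - \<sigma> * integral {0..s} (\<lambda>s. h s * f s * w s)) * (h s * f s)) / (f s * f s)
        = - (h s * x s)"
      unfolding xy[OF s(1)] y_def by (rule quotient[OF f(2)[OF s(1)]])
    finally show ?thesis by (rule DERIV_subset) auto
  qed
  have "((\<lambda>s. - (h s * x s)) has_integral (y t - y 0)) {0..t}"
    using t y_deriv by (intro fundamental_theorem_of_calculus)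
      (auto simp: has_real_derivative_iff_has_vector_derivative[symmetric])
  then have "integral {0..t} (\<lambda>s. - (h s * x s)) = y t - y 0" by (rule integral_unique)
  then have "- integral {0..t} (\<lambda>s. h s * x s) = y t - x0" by (simp add: y_def f)
  then show ?thesis using xy[OF t] by simp
qed

lemma LBINT_continuous_on:
  fixes g :: "real \<Rightarrow> real"
  assumes "continuous_on {0..} g"
  shows "set_integrable lborel {0..t} g" "(LBINT s:{0..t}. g s) = integral {0..t} g"
proof -
  show *: "set_integrable lborel {0..t} g"
    by (intro borel_integrable_atLeastAtMost' continuous_on_subset[OF assms]) auto
  show "(LBINT s:{0..t}. g s) = integral {0..t} g"
    by (rule set_borel_integral_eq_integral(2)[OF *])
qed

theorem proposition1:
  fixes M :: "'a measure" and B :: "real \<Rightarrow> 'a \<Rightarrow> real" and q\<^sub>0 d\<^sub>0 \<sigma> b :: real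
  assumes "prob_space M"
    and "standard_brownian_motion M B"
    and "q\<^sub>0 > 0" and "d\<^sub>0 > 0" and "\<sigma> > 0" and "0 < b" and "b \<le> 1"
  shows "unique_strong_solution M B
           (\<lambda>t q. - (d\<^sub>0 * q / (1 + b * d\<^sub>0 * t))) (\<lambda>t q. \<sigma>) q\<^sub>0
           (\<lambda>t \<omega>. q\<^sub>0 * (1 + b * d\<^sub>0 * t) powr (- 1 / b)
              + \<sigma> * (1 + b * d\<^sub>0 * t) powr (- 1 / b)
                * ito_integral M (brownian_filtration M B) B
                    (\<lambda>u \<omega>'. (1 + b * d\<^sub>0 * u) powr (1 / b)) t \<omega>)"
proof -
  interpret brownian_motion M B
    using assms(1,2) by (simp add: brownian_motion_def brownian_motion_axioms_def)
  \<comment> \<open>The decay rate \<open>h\<close> has integral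
    \<open>ln (1 + b * d\<^sub>0 * t) / b\<close> over \<open>{0..t}\<close>; \<open>f\<close> is
    its exponential, whence the exponent \<open>1 / b\<close> and the rule that the derivative of
    \<open>f\<close> is \<open>h * f\<close>.\<close>
  define f where "f u = (1 + b * d\<^sub>0 * u) powr (1 / b)" for u
  define h where "h u = d\<^sub>0 / (1 + b * d\<^sub>0 * u)" for u
  define J where "J = ito_integral M F B (\<lambda>u \<omega>. f u)"
  define S where "S = ito_integral M F B (\<lambda>u \<omega>. \<sigma>)"
  define X where "X t \<omega> = (q\<^sub>0 + \<sigma> * J t \<omega>) / f t" for t \<omega>
  have pos: "0 < 1 + b * d\<^sub>0 * t" if "0 \<le> t" for t
    using assms that by (simp add: add_pos_nonneg)
  have f_deriv: "(f has_real_derivative h t * f t) (at t)" if "0 \<le> t" for t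
  proof -
    have "(f has_real_derivative 1 / b * (1 + b * d\<^sub>0 * t) powr (1 / b - 1) * (b * d\<^sub>0)) (at t)"
      unfolding f_def using pos[OF that] by (auto intro!: derivative_eq_intros)
    also have "1 / b * (1 + b * d\<^sub>0 * t) powr (1 / b - 1) * (b * d\<^sub>0) = h t * f t"
      using pos[OF that] assms by (simp add: powr_diff h_def f_def)
    finally show ?thesis .
  qed
  have f_nz: "f t \<noteq> 0" if "0 \<le> t" for t using pos[OF that] by (simp add: f_def)
  have f0: "f 0 = 1" by (simp add: f_def)
  have h: "continuous_on {0..} h"
    unfolding h_def using pos by (intro continuous_intros) (auto simp: less_imp_neq[symmetric])
  have f: "continuous_on {0..} f"
    by (rule DERIV_continuous_on[where D="\<lambda>t. h t * f t"], rule has_field_derivative_at_within, rule f_deriv) simp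
  have J: "is_ito_integral M F B (\<lambda>u \<omega>. f u) J"
    and J_eq: "AE \<omega> in M. \<forall>t\<ge>0. J t \<omega> = f t * B t \<omega> - integral {0..t} (\<lambda>s. h s * f s * B s \<omega>)"
    unfolding J_def
    by (rule deterministic_ito_integral[OF f_deriv continuous_on_mult[OF h f]]; assumption)+
  \<comment> \<open>A constant integrand has derivative 0, so the integral term of the by-parts
    formula disappears.\<close>
  have S_eq: "AE \<omega> in M. \<forall>t\<ge>0. S t \<omega> = \<sigma> * B t \<omega>"
    using deterministic_ito_integral(2)[of "\<lambda>_. \<sigma>" "\<lambda>_. 0"] by (simp add: S_def)
  have X_cont: "AE \<omega> in M. continuous_on {0..} (\<lambda>t. X t \<omega>)"
  proof -
    have "AE \<omega> in M. continuous_on {0..} (\<lambda>t. J t \<omega>)"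
      using J by (simp add: is_ito_integral_def continuous_paths_def)
    then show ?thesis
      unfolding X_def by eventually_elim (use f f_nz in \<open>intro continuous_intros; auto\<close>)
  qed
  \<comment> \<open>\<open>J_eq\<close> puts \<open>X\<close> in the form required by
    \<open>variation_of_constants\<close> with the Brownian path as \<open>w\<close>;
    \<open>S_eq\<close> then turns the forcing back into the Ito term of the equation.\<close>
  have X_eq: "AE \<omega> in M. \<forall>t\<ge>0. X t \<omega> = q\<^sub>0 - integral {0..t} (\<lambda>s. h s * X s \<omega>) + S t \<omega>"
    using J_eq S_eq B_continuous
  proof eventually_elim
    case (elim \<omega>)
    show ?case
    proof (intro allI impI)
      fix t :: real assume t: "0 \<le> t"
      have "X t \<omega> = q\<^sub>0 - integral {0..t} (\<lambda>s. h s * X s \<omega>) + \<sigma> * B t \<omega>"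
        by (rule variation_of_constants[OF f_deriv f_nz f0 h elim(3) _ t])
           (use elim(1) in \<open>simp_all add: X_def\<close>)
      then show "X t \<omega> = q\<^sub>0 - integral {0..t} (\<lambda>s. h s * X s \<omega>) + S t \<omega>"
        using elim(2) t by simp
    qed
  qed
  have drift: "- (d\<^sub>0 * q / (1 + b * d\<^sub>0 * s)) = - (h s * q)" for s q
    by (simp add: h_def)
  have drift_cont: "continuous_on {0..} (\<lambda>s. - (h s * x s))" if "continuous_on {0..} x" for x
    by (intro continuous_on_minus continuous_on_mult h that)
  have "strong_solution M B (\<lambda>t q. - (h t * q)) (\<lambda>t q. \<sigma>) q\<^sub>0 X"
    unfolding strong_solution_def S_def[symmetric]
  proof (intro conjI)
    show "adapted_process F X"
      unfolding adapted_process_def X_def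
    proof (intro allI impI)
      fix t :: real assume "0 \<le> t"
      then have [measurable]: "J t \<in> borel_measurable (F t)"
        using J by (simp add: is_ito_integral_def adapted_process_def)
      show "(\<lambda>\<omega>. (q\<^sub>0 + \<sigma> * J t \<omega>) / f t) \<in> borel_measurable (F t)" by measurable
    qed
    show "continuous_paths M X" using X_cont by (simp add: continuous_paths_def)
    show "AE \<omega> in M. X 0 \<omega> = q\<^sub>0"
      using J_eq B_zero by eventually_elim (simp add: X_def f0)
    show "AE \<omega> in M. \<forall>t\<ge>0. set_integrable lborel {0..t} (\<lambda>s. - (h s * X s \<omega>))"
      using X_cont by eventually_elim (intro allI impI LBINT_continuous_on drift_cont)
    show "ito_integrable M F (\<lambda>s \<omega>. \<sigma>)"
      by (rule ito_integrable_deterministic) (rule continuous_on_const)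
    show "AE \<omega> in M. \<forall>t\<ge>0. X t \<omega> = q\<^sub>0 + (LBINT s:{0..t}. - (h s * X s \<omega>)) + S t \<omega>"
      using X_cont X_eq
      by eventually_elim (simp add: LBINT_continuous_on(2)[OF drift_cont])
  qed
  \<comment> \<open>Both processes satisfy the same path equation with forcing \<open>S\<close>, off
    a null set that does not depend on t, so the pathwise uniqueness lemma gives equality at all
    times together.\<close>
  moreover have "indistinguishable M Y X"
    if Y: "strong_solution M B (\<lambda>t q. - (h t * q)) (\<lambda>t q. \<sigma>) q\<^sub>0 Y" for Y
  proof -
    have "AE \<omega> in M. continuous_on {0..} (\<lambda>t. Y t \<omega>)"
      and "AE \<omega> in M. \<forall>t\<ge>0. Y t \<omega> = q\<^sub>0 + (LBINT s:{0..t}. - (h s * Y s \<omega>)) + S t \<omega>"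
      using Y by (simp_all add: strong_solution_def continuous_paths_def S_def)
    then show ?thesis
      unfolding indistinguishable_def using X_cont X_eq
    proof eventually_elim
      case (elim \<omega>)
      have "Y t \<omega> = q\<^sub>0 - integral {0..t} (\<lambda>s. h s * Y s \<omega>) + S t \<omega>" if "0 \<le> t" for t
        using elim(2) that by (simp add: LBINT_continuous_on(2)[OF drift_cont[OF elim(1)]])
      then show ?case
        using elim(4) by (intro allI impI linear_integral_equation_unique[OF f_deriv f_nz h elim(1,3)]) auto
    qed
  qed
  ultimately have "unique_strong_solution M B (\<lambda>t q. - (h t * q)) (\<lambda>t q. \<sigma>) q\<^sub>0 X"
    by (simp add: unique_strong_solution_def)
  moreover have "X = (\<lambda>t \<omega>. q\<^sub>0 * (1 + b * d\<^sub>0 * t) powr (- 1 / b)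
      + \<sigma> * (1 + b * d\<^sub>0 * t) powr (- 1 / b) * J t \<omega>)"
    by (simp add: X_def f_def powr_minus fun_eq_iff minus_divide_left[symmetric] divide_inverse algebra_simps)
  ultimately show ?thesis
    unfolding drift J_def f_def by simp
qed

end
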